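(* Let $C$ be a non-trivial perfect finite permutation group on a finite set $X$, and let $W_C$ be the associated infinite iterated wreath product. Then there exists a countably generated recursively enumerable presentation $\langle S \mid \mathcal U \rangle$ of the group $W_C$ with an undecidable word problem.
   Context: The group $W_C$: let $q=|X|$. Define permutation groups $G_n$ acting on $X^n$ by letting $G_0=\{1\}$ be the trivial group (acting on the one-point set $X^0$) and $G_{n+1}=C\wr G_n=B_n\rtimes G_n$, the permutational wreath product, where $B_n=C^{X^n}$ is the direct product of $q^n$ copies of $C$ indexed by $X^n$ and $G_n$ acts on $B_n$ by permuting these copies according to its action on $X^n$; the group $G_{n+1}$ acts on $X^{n+1}=X^n\times X$ in the standard imprimitive way (so $G_1=C$, and by associativity of the permutational wreath product $G_{n+1}\cong G_n\wr C$ for $n\ge 1$). Let $\psi_n:G_n\to G_{n+1}=B_n\rtimes G_n$ be the canonical embedding of $G_n$ as the complement of $B_n$. Then $W_C=\lim_{n\to\infty}G_n$ is the direct limit of the groups $G_n$ along the embeddings $\psi_n$ (it is P. Hall's wreath product $\mathrm{Wr}_{i\in\mathbb Z_-}C$ indexed by the negative integers). A countably generated recursively enumerable presentation $\langle S\mid\mathcal U\rangle$ of a group $G$ consists of a countably infinite alphabet of generators $S=\{s_1,s_2,\ldots\}$ (formal letters indexed by the positive integers; different letters may represent equal elements of $G$, possibly trivial) and an algorithmically enumerable set $\mathcal U$ of words in $S\cup S^{-1}$, the defining relations, such that $G$ is (isomorphic to) the quotient of the free group on $S$ by the normal closure of this set. Words in $S\cup S^{-1}$ are encoded as finite words in a finite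 alphabet in the evident effective way. The word problem of the presentation is undecidable if there is no algorithm that, given a word $x$ in $S\cup S^{-1}$, decides whether $x=1$ in the presented group. *)

theory Defs
  imports "HOL-Algebra.Bij" "HOL-Algebra.Generated_Groups" "HOL-Algebra.Product_Groups" "HOL-Library.Nat_Bijection"
begin

section \<open>Partial recursive functions\<close>

datatype recf = Zero | Succ | Proj nat | Comp recf "recf list" | PrimRec recf recf | Minim recf

text \<open>\<open>computes f xs y\<close>: the partial recursive function with program \<open>f\<close> is defined on the
  argument list \<open>xs\<close>, with value \<open>y\<close>.  Recursion and minimisation act on the first argument.\<close>

inductive computes :: "recf \<Rightarrow> nat list \<Rightarrow> nat \<Rightarrow> bool" where
  "computes Zero xs 0"
| "computes Succ (x # xs) (Suc x)"
| "i < length xs \<Longrightarrow> computes (Proj i) xs (xs ! i)"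
| "\<lbrakk>length ys = length gs; \<forall>i < length gs. computes (gs ! i) xs (ys ! i); computes f ys z\<rbrakk>
     \<Longrightarrow> computes (Comp f gs) xs z"
| "computes f xs y \<Longrightarrow> computes (PrimRec f g) (0 # xs) y"
| "\<lbrakk>computes (PrimRec f g) (n # xs) y; computes g (n # y # xs) z\<rbrakk>
     \<Longrightarrow> computes (PrimRec f g) (Suc n # xs) z"
| "\<lbrakk>computes f (n # xs) 0; \<forall>m < n. \<exists>y. computes f (m # xs) (Suc y)\<rbrakk>
     \<Longrightarrow> computes (Minim f) xs n"

text \<open>Enumerable sets are the ranges of partial recursive functions; this includes the empty set.\<close>

definition recursively_enumerable :: "nat set \<Rightarrow> bool" where
  "recursively_enumerable A \<longleftrightarrow> (\<exists>f. A = {y. \<exists>x. computes f [x] y})"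

definition decidable :: "nat set \<Rightarrow> bool" where
  "decidable A \<longleftrightarrow> (\<exists>f. \<forall>x. computes f [x] (if x \<in> A then 1 else 0))"


section \<open>Free groups and presentations\<close>

text \<open>Words in \<open>S \<union> S\<^sup>-\<^sup>1\<close>, where the letter \<open>Inl s\<close> stands for \<open>s\<close> and \<open>Inr s\<close> for its formal inverse.\<close>

type_synonym 's gword = "('s + 's) list"

fun letter_inv :: "'s + 's \<Rightarrow> 's + 's" where
  "letter_inv (Inl s) = Inr s"
| "letter_inv (Inr s) = Inl s"

definition free_step :: "('s gword \<times> 's gword) set" where
  "free_step = {(u @ a # letter_inv a # v, u @ v) | u a v. True}"

definition free_rel :: "('s gword \<times> 's gword) set" where
  "free_rel = (free_step \<union> free_step\<inverse>)\<^sup>*"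

definition free_class :: "'s gword \<Rightarrow> 's gword set" where
  "free_class w = free_rel `` {w}"

definition free_group :: "'s gword set monoid" where
  "free_group = \<lparr>carrier = UNIV // free_rel,
                 monoid.mult = \<lambda>A B. \<Union>u\<in>A. \<Union>v\<in>B. free_class (u @ v),
                 one = free_class []\<rparr>"

definition normal_closure :: "('g, 'm) monoid_scheme \<Rightarrow> 'g set \<Rightarrow> 'g set" where
  "normal_closure G U = \<Inter>{N. N \<lhd> G \<and> U \<subseteq> N}"

definition relators :: "'s gword set \<Rightarrow> 's gword set set" where
  "relators U = normal_closure free_group (free_class ` U)"

definition presented_group :: "'s gword set \<Rightarrow> 's gword set set monoid" where
  "presented_group U = free_group Mod relators U"

definition word_value :: "'s gword set \<Rightarrow> 's gword \<Rightarrow> 's gword set set" where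
  "word_value U w = relators U #>\<^bsub>free_group\<^esub> free_class w"

text \<open>The alphabet of a countably generated presentation is \<open>nat\<close>, with \<open>i\<close> in the role of
  $s_{i+1}$.  Words are represented by their (bijective) Goedel numbers.\<close>

definition word_code :: "nat gword \<Rightarrow> nat" where
  "word_code w = list_encode (map sum_encode w)"

definition re_presentation :: "nat gword set \<Rightarrow> bool" where
  "re_presentation U \<longleftrightarrow> recursively_enumerable (word_code ` U)"

definition decidable_word_problem :: "nat gword set \<Rightarrow> bool" where
  "decidable_word_problem U \<longleftrightarrow>
     decidable (word_code ` {w. word_value U w = \<one>\<^bsub>presented_group U\<^esub>})"


section \<open>Permutation groups and iterated wreath products\<close>

definition perm_group :: "'a set \<Rightarrow> ('a \<Rightarrow> 'a) set \<Rightarrow> ('a \<Rightarrow> 'a) monoid" where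
  "perm_group X P = (BijGroup X)\<lparr>carrier := P\<rparr>"

definition perfect_group :: "('g, 'm) monoid_scheme \<Rightarrow> bool" where
  "perfect_group G \<longleftrightarrow> group G \<and> derived G (carrier G) = carrier G"

text \<open>The semidirect product \<open>B \<rtimes> G\<close> for the left action \<open>\<alpha>\<close> of \<open>G\<close> on \<open>B\<close>.  The pair
  \<open>(b, g)\<close> is written as the list \<open>b # g\<close>, so that all iterated products have the same type.\<close>

definition semidirect :: "'b monoid \<Rightarrow> 'b list monoid \<Rightarrow> ('b list \<Rightarrow> 'b \<Rightarrow> 'b) \<Rightarrow> 'b list monoid" where
  "semidirect B G \<alpha> =
     \<lparr>carrier = {b # g | b g. b \<in> carrier B \<and> g \<in> carrier G},
      monoid.mult = \<lambda>z w. (hd z \<otimes>\<^bsub>B\<^esub> \<alpha> (tl z) (hd w)) # (tl z \<otimes>\<^bsub>G\<^esub> tl w),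
      one = \<one>\<^bsub>B\<^esub> # \<one>\<^bsub>G\<^esub>\<rparr>"

text \<open>$X^n$.  The point \<open>(v, x)\<close> of $X^{n+1} = X^n \times X$ is the list \<open>x # v\<close>.\<close>

definition points :: "'a set \<Rightarrow> nat \<Rightarrow> 'a list set" where
  "points X n = {v. length v = n \<and> set v \<subseteq> X}"

text \<open>The imprimitive action: \<open>(b, g)\<close> maps \<open>(v, x)\<close> to \<open>(g v, b (g v) x)\<close>.\<close>

fun wr_act :: "('a list \<Rightarrow> 'a \<Rightarrow> 'a) list \<Rightarrow> 'a list \<Rightarrow> 'a list" where
  "wr_act (b # g) (x # v) = b (wr_act g v) x # wr_act g v"
| "wr_act _ _ = []"

definition base_group :: "'a set \<Rightarrow> ('a \<Rightarrow> 'a) set \<Rightarrow> nat \<Rightarrow> ('a list \<Rightarrow> 'a \<Rightarrow> 'a) monoid" where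
  "base_group X P n = product_group (points X n) (\<lambda>_. perm_group X P)"

primrec iter_wreath :: "'a set \<Rightarrow> ('a \<Rightarrow> 'a) set \<Rightarrow> nat \<Rightarrow> ('a list \<Rightarrow> 'a \<Rightarrow> 'a) list monoid" where
  "iter_wreath X P 0 = \<lparr>carrier = {[]}, monoid.mult = \<lambda>_ _. [], one = []\<rparr>"
| "iter_wreath X P (Suc n) =
     semidirect (base_group X P n) (iter_wreath X P n)
       (\<lambda>g b. \<lambda>v\<in>points X n. b (wr_act (inv\<^bsub>iter_wreath X P n\<^esub> g) v))"

definition wreath_embed ::
    "'a set \<Rightarrow> ('a \<Rightarrow> 'a) set \<Rightarrow> nat \<Rightarrow> ('a list \<Rightarrow> 'a \<Rightarrow> 'a) list \<Rightarrow> ('a list \<Rightarrow> 'a \<Rightarrow> 'a) list" where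
  "wreath_embed X P n g = \<one>\<^bsub>base_group X P n\<^esub> # g"


section \<open>Direct limits of sequences of groups\<close>

text \<open>\<open>transition \<psi> m k\<close> is the composite \<open>\<psi> (m + k - 1) \<circ> \<dots> \<circ> \<psi> m\<close> from the \<open>m\<close>-th to
  the \<open>(m + k)\<close>-th group of the sequence.\<close>

primrec transition :: "(nat \<Rightarrow> 'g \<Rightarrow> 'g) \<Rightarrow> nat \<Rightarrow> nat \<Rightarrow> 'g \<Rightarrow> 'g" where
  "transition \<psi> m 0 = id"
| "transition \<psi> m (Suc k) = \<psi> (m + k) \<circ> transition \<psi> m k"

definition limit_points :: "(nat \<Rightarrow> 'g monoid) \<Rightarrow> (nat \<times> 'g) set" where
  "limit_points G = (SIGMA n:UNIV. carrier (G n))"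

definition limit_rel ::
    "(nat \<Rightarrow> 'g monoid) \<Rightarrow> (nat \<Rightarrow> 'g \<Rightarrow> 'g) \<Rightarrow> ((nat \<times> 'g) \<times> (nat \<times> 'g)) set" where
  "limit_rel G \<psi> = {((m, g), (n, h)). (m, g) \<in> limit_points G \<and> (n, h) \<in> limit_points G \<and>
     (\<exists>k l. m + k = n + l \<and> transition \<psi> m k g = transition \<psi> n l h)}"

definition limit_mult ::
    "(nat \<Rightarrow> 'g monoid) \<Rightarrow> (nat \<Rightarrow> 'g \<Rightarrow> 'g) \<Rightarrow> nat \<times> 'g \<Rightarrow> nat \<times> 'g \<Rightarrow> nat \<times> 'g" where
  "limit_mult G \<psi> = (\<lambda>(m, g) (n, h).
     (max m n, transition \<psi> m (max m n - m) g \<otimes>\<^bsub>G (max m n)\<^esub> transition \<psi> n (max m n - n) h))"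

definition direct_limit ::
    "(nat \<Rightarrow> 'g monoid) \<Rightarrow> (nat \<Rightarrow> 'g \<Rightarrow> 'g) \<Rightarrow> (nat \<times> 'g) set monoid" where
  "direct_limit G \<psi> =
     \<lparr>carrier = limit_points G // limit_rel G \<psi>,
      monoid.mult = \<lambda>A B. \<Union>p\<in>A. \<Union>q\<in>B. limit_rel G \<psi> `` {limit_mult G \<psi> p q},
      one = limit_rel G \<psi> `` {(0, \<one>\<^bsub>G 0\<^esub>)}\<rparr>"

definition wreath_limit ::
    "'a set \<Rightarrow> ('a \<Rightarrow> 'a) set \<Rightarrow> (nat \<times> ('a list \<Rightarrow> 'a \<Rightarrow> 'a) list) set monoid" where
  "wreath_limit X P = direct_limit (iter_wreath X P) (wreath_embed X P)"

end

theory Submission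
  imports Defs
begin

text \<open>Writing points of the tree in base \<open>q = |X|\<close> turns $W_C$ into a group of permutations of
  the natural numbers, generated by the maps which apply an element of \<open>C\<close> to the digit \<open>m\<close> of the
  numbers with a prescribed sequence \<open>v\<close> of lower digits.  Fix a computable \<open>a\<close> that tends to
  infinity, but such that no algorithm decides, given \<open>m\<close> and \<open>s\<close>, whether \<open>a u \<le> m\<close> for some
  \<open>u \<ge> s\<close>.  The generators carry a further parameter \<open>s\<close>, and a generator of level \<open>m\<close> and birth
  date \<open>s\<close> is declared to be trivial if such a \<open>u\<close> exists, and to be the map above otherwise.
  As \<open>a\<close> tends to infinity, the whole group is still generated, but triviality of
  generators is undecidable.

  The set of all trivial words is nevertheless enumerable.  The letters of a word which are alive
  at stage \<open>t\<close> and die later are those of level at least \<open>\<nu>\<close>, the least value of \<open>a\<close> from \<open>t\<close> on,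
  and the word in which they are deleted is the image of the word under the retraction of $W_C$
  onto the group $G_\nu$ acting on the first \<open>\<nu>\<close> digits.  So a word which is trivial at some stage
  after the birth of all its letters remains trivial forever, and it is enough to wait for such a
  stage.\<close>


section \<open>Computable functions\<close>

definition computable :: "(nat \<Rightarrow> nat) \<Rightarrow> bool" where
  "computable f \<longleftrightarrow> (\<exists>p. \<forall>x. computes p [x] (f x))"

definition computable2 :: "(nat \<Rightarrow> nat \<Rightarrow> nat) \<Rightarrow> bool" where
  "computable2 f \<longleftrightarrow> (\<exists>p. \<forall>x y. computes p [x, y] (f x y))"

definition decidable_pred :: "(nat \<Rightarrow> bool) \<Rightarrow> bool" where
  "decidable_pred P \<longleftrightarrow> computable (\<lambda>x. of_bool (P x))"

named_theorems computable_intros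

lemma all_less_two: "(\<forall>i<Suc (Suc 0). P i) \<longleftrightarrow> P 0 \<and> P 1"
  by (auto simp: less_Suc_eq)

text \<open>Programs are deterministic: the premises of the applicable rule are unique by induction,
  and for minimisation the smaller of two results would be both a zero and a non-zero of the search.
  Any known value then excludes all others.\<close>

lemma computes_unique: "computes f xs y \<Longrightarrow> computes f xs z \<Longrightarrow> y = z"
proof (induction arbitrary: z rule: computes.induct)
  case (4 ys gs xs f w)
  from 4(5) obtain ys' where ys': "length ys' = length gs"
    "\<forall>i<length gs. computes (gs ! i) xs (ys' ! i)" "computes f ys' z" by cases auto
  have *: "ys ! i = ys' ! i" if "i < length gs" for i
    using "4.IH"(1) ys'(2) that by blast
  have "ys = ys'"
    by (rule nth_equalityI) (use "4.hyps" ys'(1) * in auto)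
  then show ?case using "4.IH"(2) ys'(3) by blast
next
  case (5 f xs y g)
  from "5.prems" show ?case by cases (use "5.IH" in auto)
next
  case (6 f g n xs y w)
  from "6.prems" show ?case by cases (use 6 in auto)
next
  case (7 f n xs)
  from "7.prems" obtain "computes f (z # xs) 0" "\<forall>m<z. \<exists>y. computes f (m # xs) (Suc y)" by cases auto
  then show ?case using 7 by (metis nat.distinct(1) nat_neq_iff)
qed (auto elim: computes.cases)

lemma computes_Proj: "i < length xs \<Longrightarrow> y = xs ! i \<Longrightarrow> computes (Proj i) xs y"
  by (simp add: computes.intros(3))

lemma computes_Comp1:
  "computes g xs y \<Longrightarrow> computes f [y] z \<Longrightarrow> computes (Comp f [g]) xs z"
  by (rule computes.intros(4)[where ys = "[y]"]) simp_all

lemma computes_Comp2: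
  assumes "computes g xs y" "computes g' xs y'" "computes f [y, y'] z"
  shows "computes (Comp f [g, g']) xs z"
  by (rule computes.intros(4)[where ys = "[y, y']"]) (use assms in \<open>auto simp: less_Suc_eq\<close>)

lemma computes_Const: "\<exists>p. \<forall>xs. computes p xs c"
proof (induction c)
  case (Suc c)
  then obtain p where "\<forall>xs. computes p xs c" by blast
  then have "\<forall>xs. computes (Comp Succ [p]) xs (Suc c)"
    by (blast intro: computes_Comp1 computes.intros(2))
  then show ?case by blast
qed (blast intro: computes.intros(1))

lemma computes_PrimRec:
  assumes f: "computes f xs b"
    and g: "\<And>i r. computes g (i # r # xs) (s i r)"
  shows "computes (PrimRec f g) (n # xs) (rec_nat b s n)"
  by (induction n) (auto intro: computes.intros(5,6) f g)

text \<open>\<open>Minim\<close> looks for a zero, so the program must return 0 where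
  \<open>P\<close> holds and a successor before; hence the negation under
  \<open>of_bool\<close>.\<close>

lemma computes_Minim:
  assumes f: "\<And>m. computes f (m # xs) (of_bool (\<not> P m))" and ex: "\<exists>n. P n"
  shows "computes (Minim f) xs (LEAST n. P n)"
proof (rule computes.intros(7))
  show "computes f ((LEAST n. P n) # xs) 0"
    using f[of "LEAST n. P n"] LeastI_ex[OF ex] by simp
  show "\<forall>m<LEAST n. P n. \<exists>y. computes f (m # xs) (Suc y)"
    using f not_less_Least by (metis One_nat_def of_bool_eq(2))
qed

section \<open>Closure properties of computable functions\<close>

lemma computable_const[computable_intros]: "computable (\<lambda>x. c)"
  using computes_Const unfolding computable_def by blast

lemma computable_id[computable_intros]: "computable (\<lambda>x. x)"
  unfolding computable_def by (rule exI[of _ "Proj 0"]) (auto intro: computes_Proj)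

lemma computable_Suc[computable_intros]: "computable f \<Longrightarrow> computable (\<lambda>x. Suc (f x))"
  unfolding computable_def by (blast intro: computes_Comp1 computes.intros(2))

lemma computable_comp: "computable h \<Longrightarrow> computable f \<Longrightarrow> computable (\<lambda>x. h (f x))"
  unfolding computable_def by (blast intro: computes_Comp1)

lemma computable_comp2: "computable2 h \<Longrightarrow> computable f \<Longrightarrow> computable g \<Longrightarrow> computable (\<lambda>x. h (f x) (g x))"
  unfolding computable_def computable2_def by (blast intro: computes_Comp2)

lemma computable2_fst: assumes "computable f" shows "computable2 (\<lambda>x y. f x)"
proof -
  obtain p where p: "\<And>x. computes p [x] (f x)" using assms computable_def by auto
  have "computes (Comp p [Proj (0)]) [x, y] (f x)" for x y
    by (rule computes_Comp1[OF computes_Proj p]) auto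
  then show ?thesis unfolding computable2_def by blast
qed

lemma computable2_snd: assumes "computable f" shows "computable2 (\<lambda>x y. f y)"
proof -
  obtain p where p: "\<And>x. computes p [x] (f x)" using assms computable_def by auto
  have "computes (Comp p [Proj (Suc 0)]) [x, y] (f y)" for x y
    by (rule computes_Comp1[OF computes_Proj p]) auto
  then show ?thesis unfolding computable2_def by blast
qed

lemma computable2_comp: "computable h \<Longrightarrow> computable2 f \<Longrightarrow> computable2 (\<lambda>x y. h (f x y))"
  unfolding computable_def computable2_def by (blast intro: computes_Comp1)

lemma computable2_comp2: "computable2 h \<Longrightarrow> computable2 f \<Longrightarrow> computable2 g \<Longrightarrow> computable2 (\<lambda>x y. h (f x y) (g x y))"
  unfolding computable2_def by (meson computes_Comp2)

lemma computable2_swap: "computable2 h \<Longrightarrow> computable2 (\<lambda>x y. h y x)"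
  by (rule computable2_comp2[where f = "\<lambda>x y. y" and g = "\<lambda>x y. x"])
     (auto intro: computable2_fst computable2_snd computable_id)

lemma computable_primrec: assumes "computable2 s" shows "computable (rec_nat b s)"
proof -
  obtain p where p: "\<forall>x y. computes p [x, y] (s x y)" using assms computable2_def by auto
  obtain c where c: "\<forall>xs. computes c xs b" using computes_Const by blast
  have "computes (PrimRec c p) [x] (rec_nat b s x)" for x
    using computes_PrimRec[where xs = "[]"] p c by blast
  then show ?thesis unfolding computable_def by blast
qed

text \<open>Iterating a unary step is enough for addition and truncated subtraction; recursion with
  a general step has to wait for pairing.\<close>

lemma computable2_iter: assumes "computable s" "computable b" shows "computable2 (\<lambda>n x. rec_nat (b x) (\<lambda>_. s) n)"
proof -
  obtain p where p: "\<forall>x. computes p [x] (s x)" using assms computable_def by auto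
  obtain c where c: "\<forall>x. computes c [x] (b x)" using assms computable_def by auto
  have "computes (Comp p [Proj 1]) [i, r, x] (s r)" for i r x
    by (rule computes_Comp1[OF computes_Proj]) (use p in auto)
  then have "computes (PrimRec c (Comp p [Proj 1])) [n, x] (rec_nat (b x) (\<lambda>_. s) n)" for n x
    using c by (intro computes_PrimRec) auto
  then show ?thesis unfolding computable2_def by blast
qed

lemma computable2_add: "computable2 (+)"
proof -
  have "rec_nat y (\<lambda>_. Suc) x = x + y" for x y by (induction x) auto
  then show ?thesis using computable2_iter[of Suc "\<lambda>x. x"] computable_Suc[OF computable_id] computable_id by simp
qed

lemma computable_pred: "computable (\<lambda>x. x - 1)"
proof -
  have "rec_nat 0 (\<lambda>i r. i) x = x - 1" for x by (cases x) auto
  then show ?thesis using computable_primrec[OF computable2_fst[OF computable_id], of 0] by presburger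
qed

lemma computable2_diff: "computable2 (-)"
proof -
  have "rec_nat y (\<lambda>_ r. r - 1) x = y - x" for x y by (induction x) auto
  then show ?thesis using computable2_swap[OF computable2_iter[OF computable_pred computable_id]] by simp
qed

lemma computable_triangle: "computable triangle"
proof -
  have "computable2 (\<lambda>i r. r + Suc i)"
    by (intro computable2_comp2[OF computable2_add] computable2_snd computable2_fst computable_Suc computable_id)
  moreover have "rec_nat 0 (\<lambda>i r. r + Suc i) n = triangle n" for n by (induction n) auto
  ultimately show ?thesis using computable_primrec[of "\<lambda>i r. r + Suc i" 0] by presburger
qed

section \<open>Cantor pairing and its computable inverses\<close>

definition pr :: "nat \<Rightarrow> nat \<Rightarrow> nat" where "pr a b = prod_encode (a, b)"
definition p1 :: "nat \<Rightarrow> nat" where "p1 z = fst (prod_decode z)"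
definition p2 :: "nat \<Rightarrow> nat" where "p2 z = snd (prod_decode z)"

lemma p1_pr[simp]: "p1 (pr a b) = a" and p2_pr[simp]: "p2 (pr a b) = b"
  by (simp_all add: p1_def p2_def pr_def)

lemma pr_p1_p2[simp]: "pr (p1 z) (p2 z) = z"
  by (simp add: p1_def p2_def pr_def)

lemma p1_0[simp]: "p1 0 = 0" and p2_0[simp]: "p2 0 = 0"
  using p1_pr[of 0 0] p2_pr[of 0 0] by (simp_all add: pr_def prod_encode_def)

lemma pr_eq_iff[simp]: "pr a b = pr c d \<longleftrightarrow> a = c \<and> b = d"
  by (simp add: pr_def)

lemma le_pr1: "a \<le> pr a b" and le_pr2: "b \<le> pr a b"
  by (simp_all add: pr_def le_prod_encode_1 le_prod_encode_2)

lemma p1_le: "p1 z \<le> z" and p2_le: "p2 z \<le> z"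
  by (metis le_pr1 pr_p1_p2, metis le_pr2 pr_p1_p2)

lemma triangle_mono: "m \<le> n \<Longrightarrow> triangle m \<le> triangle n"
  by (induction rule: dec_induct) auto

text \<open>The index of the Cantor diagonal through \<open>z\<close>, that is, the sum of its two
  coordinates. Finding it by search is what makes decoding computable.\<close>

definition diag :: "nat \<Rightarrow> nat" where "diag z = (LEAST k. z < triangle (Suc k))"

lemma diag_pr: "diag (pr a b) = a + b"
  unfolding diag_def
proof (rule Least_equality)
  show "pr a b < triangle (Suc (a + b))" by (simp add: pr_def prod_encode_def)
  fix k assume "pr a b < triangle (Suc k)"
  then have "\<not> triangle (Suc k) \<le> triangle (a + b)" by (simp add: pr_def prod_encode_def)
  then show "a + b \<le> k" using triangle_mono not_less_eq_eq by blast
qed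

lemma computable_diag: "computable diag"
proof -
  have "computable2 (\<lambda>k z. Suc z - triangle (Suc k))"
    by (intro computable2_comp2[OF computable2_diff] computable2_snd computable2_fst computable_Suc computable_id computable_comp[OF computable_triangle])
  \<comment> \<open>Two truncated subtractions from 1 turn every positive number into 1, which gives
    the 0/1 test for minimisation.\<close>
  from this have "computable2 (\<lambda>k z. 1 - (1 - (Suc z - triangle (Suc k))))"
    by (intro computable2_comp2[OF computable2_diff] computable2_fst[OF computable_const] computable2_snd computable2_fst computable_Suc computable_id computable_comp[OF computable_triangle])
  moreover have "1 - (1 - (Suc z - triangle (Suc k))) = of_bool (\<not> z < triangle (Suc k))" for k z
    by (auto simp: of_bool_def)
  ultimately obtain p where p: "\<And>k z. computes p [k, z] (of_bool (\<not> z < triangle (Suc k)))"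
    unfolding computable2_def by (metis (lifting))
  have "n \<le> triangle n" for n by (induction n) auto
  then have ex: "\<exists>k. z < triangle (Suc k)" for z by (meson Suc_le_eq)
  have "computes (Minim p) [z] (diag z)" for z
    unfolding diag_def using computes_Minim[OF p ex] .
  then show ?thesis unfolding computable_def by blast
qed

text \<open>As \<open>pr a b = triangle (a + b) + a\<close>, the diagonal index determines first
  \<open>a\<close> and then \<open>b\<close>.\<close>

lemma computable_p1: "computable p1" and computable_p2: "computable p2"
proof -
  have "p1 z = z - triangle (diag z)" for z
    using diag_pr[of "p1 z" "p2 z"] pr_def[of "p1 z" "p2 z"] by (simp add: prod_encode_def)
  then have "p1 = (\<lambda>z. z - triangle (diag z))" by blast
  moreover have "computable (\<lambda>z. z - triangle (diag z))"
    by (intro computable_comp2[OF computable2_diff] computable_id computable_comp[OF computable_triangle computable_diag])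
  ultimately show *: "computable p1" by simp
  have "p2 z = diag z - p1 z" for z using diag_pr[of "p1 z" "p2 z"] by simp
  then have "p2 = (\<lambda>z. diag z - p1 z)" by blast
  moreover have "computable (\<lambda>z. diag z - p1 z)" by (intro computable_comp2[OF computable2_diff] computable_diag *)
  ultimately show "computable p2" by simp
qed

lemma computable2_pr: "computable2 pr"
proof -
  have "computable2 (\<lambda>a b. triangle (a + b) + a)"
    by (intro computable2_comp2[OF computable2_add] computable2_comp[OF computable_triangle] computable2_fst computable2_snd computable_id computable2_add)
  then show ?thesis by (simp add: pr_def[abs_def] prod_encode_def)
qed

lemmas computable_add[computable_intros] = computable_comp2[OF computable2_add]
lemmas computable_diff[computable_intros] = computable_comp2[OF computable2_diff]
lemmas computable_pr[computable_intros] = computable_comp2[OF computable2_pr]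
lemmas computable_p1'[computable_intros] = computable_comp[OF computable_p1]
lemmas computable_p2'[computable_intros] = computable_comp[OF computable_p2]

text \<open>Functions of several arguments are coded as functions of one tuple; the projections
  \<open>p1\<close> and \<open>p2\<close> play the role of de Bruijn indices under a binder.\<close>

lemma computable_pairD: assumes "computable (\<lambda>z. h (p1 z) (p2 z))" "computable f" "computable g" shows "computable (\<lambda>x. h (f x) (g x))"
  using computable_comp[OF assms(1) computable_pr[OF assms(2,3)]] by simp

text \<open>\<open>PrimRec\<close> hands counter, previous value and parameter to the step as three
  arguments; packing them by \<open>pr\<close> lets the step be a computable function of one
  tuple.\<close>

lemma computable_rec[computable_intros]:
  assumes "computable n" "computable b" "computable (\<lambda>z. s (p1 z) (p1 (p2 z)) (p2 (p2 z)))"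
  shows "computable (\<lambda>x. rec_nat (b x) (\<lambda>i r. s i r x) (n x))"
proof -
  obtain pn where pn: "\<And>x. computes pn [x] (n x)" using assms computable_def by auto
  obtain pb where pb: "\<And>x. computes pb [x] (b x)" using assms computable_def by auto
  obtain ps where ps: "\<And>z. computes ps [z] (s (p1 z) (p1 (p2 z)) (p2 (p2 z)))"
    using assms computable_def by auto
  obtain pp where pp: "\<And>x y. computes pp [x, y] (pr x y)" using computable2_pr computable2_def by auto
  let ?g = "Comp ps [Comp pp [Proj 0, Comp pp [Proj 1, Proj 2]]]"
  have "computes ?g [i, r, x] (s i r x)" for i r x
  proof (rule computes_Comp1)
    show "computes (Comp pp [Proj 0, Comp pp [Proj 1, Proj 2]]) [i, r, x] (pr i (pr r x))"
      by (rule computes_Comp2[OF computes_Proj computes_Comp2[OF computes_Proj computes_Proj pp] pp]) simp_all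
    show "computes ps [pr i (pr r x)] (s i r x)" using ps[of "pr i (pr r x)"] by simp
  qed
  then have *: "computes (PrimRec pb ?g) [k, x] (rec_nat (b x) (\<lambda>i r. s i r x) k)" for k x
    by (intro computes_PrimRec pb)
  have "computes (Comp (PrimRec pb ?g) [pn, Proj 0]) [x] (rec_nat (b x) (\<lambda>i r. s i r x) (n x))" for x
    by (rule computes_Comp2[OF pn computes_Proj *]) auto
  then show ?thesis unfolding computable_def by blast
qed

lemma computable_mult[computable_intros]: assumes "computable f" "computable g" shows "computable (\<lambda>x. f x * g x)"
proof -
  have "rec_nat 0 (\<lambda>i r. r + m) n = n * m" for n m :: nat by (induction n) auto
  moreover have "computable (\<lambda>x. rec_nat 0 (\<lambda>i r. r + g x) (f x))"
    by (intro computable_intros assms computable_comp[OF assms(2)])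
  ultimately show ?thesis by simp
qed

lemma computable_power[computable_intros]: assumes "computable f" "computable g" shows "computable (\<lambda>x. f x ^ g x)"
proof -
  have "rec_nat 1 (\<lambda>i r. r * m) n = m ^ n" for n m :: nat by (induction n) auto
  moreover have "computable (\<lambda>x. rec_nat 1 (\<lambda>i r. r * f x) (g x))"
    by (intro computable_intros assms computable_comp[OF assms(1)])
  ultimately show ?thesis by simp
qed

section \<open>Decidable predicates and bounded quantifiers\<close>

lemma computable_of_bool[computable_intros]: "decidable_pred P \<Longrightarrow> computable (\<lambda>x. of_bool (P x))"
  by (simp add: decidable_pred_def)

lemma decidable_pred_not[computable_intros]: assumes "decidable_pred P" shows "decidable_pred (\<lambda>x. \<not> P x)"
proof -
  have "computable (\<lambda>x. 1 - of_bool (P x))" by (intro computable_intros assms)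
  moreover have "(\<lambda>x. 1 - of_bool (P x)) = (\<lambda>x. of_bool (\<not> P x) :: nat)" by auto
  ultimately show ?thesis unfolding decidable_pred_def by (rule back_subst[where P = computable])
qed

lemma decidable_pred_conj[computable_intros]: assumes "decidable_pred P" "decidable_pred Q" shows "decidable_pred (\<lambda>x. P x \<and> Q x)"
proof -
  have "computable (\<lambda>x. of_bool (P x) * of_bool (Q x))" by (intro computable_intros assms)
  then show ?thesis by (simp add: decidable_pred_def of_bool_conj)
qed

lemma decidable_pred_disj[computable_intros]: assumes "decidable_pred P" "decidable_pred Q" shows "decidable_pred (\<lambda>x. P x \<or> Q x)"
  using decidable_pred_not[OF decidable_pred_conj[OF decidable_pred_not[OF assms(1)] decidable_pred_not[OF assms(2)]]] by simp

lemma decidable_pred_imp[computable_intros]: assumes "decidable_pred P" "decidable_pred Q" shows "decidable_pred (\<lambda>x. P x \<longrightarrow> Q x)"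
  using decidable_pred_disj[OF decidable_pred_not[OF assms(1)] assms(2)] by (simp only: imp_conv_disj)

lemma decidable_pred_le[computable_intros]: assumes "computable f" "computable g" shows "decidable_pred (\<lambda>x. f x \<le> g x)"
proof -
  have "computable (\<lambda>x. 1 - (f x - g x))" by (intro computable_intros assms)
  moreover have "(\<lambda>x. 1 - (f x - g x)) = (\<lambda>x. of_bool (f x \<le> g x))" by auto
  ultimately show ?thesis unfolding decidable_pred_def by (rule back_subst[where P = computable])
qed

lemma decidable_pred_less[computable_intros]: assumes "computable f" "computable g" shows "decidable_pred (\<lambda>x. f x < g x)"
  using decidable_pred_le[OF computable_Suc[OF assms(1)] assms(2)] by (simp add: Suc_le_eq)

lemma decidable_pred_eq[computable_intros]: assumes "computable f" "computable g" shows "decidable_pred (\<lambda>x. f x = g x)"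
  using decidable_pred_conj[OF decidable_pred_le[OF assms] decidable_pred_le[OF assms(2,1)]] by (simp add: eq_iff)

lemma decidable_pred_const[computable_intros]: "decidable_pred (\<lambda>x. c)"
  by (simp add: decidable_pred_def computable_const)

lemma computable_if[computable_intros]: assumes "decidable_pred P" "computable f" "computable g" shows "computable (\<lambda>x. if P x then f x else g x)"
proof -
  have "computable (\<lambda>x. of_bool (P x) * f x + of_bool (\<not> P x) * g x)" by (intro computable_intros assms)
  moreover have "(\<lambda>x. of_bool (P x) * f x + of_bool (\<not> P x) * g x) = (\<lambda>x. if P x then f x else g x)"
    by auto
  ultimately show ?thesis unfolding decidable_pred_def by (rule back_subst[where P = computable])
qed

lemma decidable_pred_comp: "decidable_pred P \<Longrightarrow> computable f \<Longrightarrow> decidable_pred (\<lambda>x. P (f x))"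
  unfolding decidable_pred_def by (rule computable_comp)

lemma decidable_pred_pairD: assumes "decidable_pred (\<lambda>z. P (p1 z) (p2 z))" "computable f" "computable g" shows "decidable_pred (\<lambda>x. P (f x) (g x))"
  using decidable_pred_comp[OF assms(1) computable_pr[OF assms(2,3)]] by simp

text \<open>A bounded universal quantifier is a product of 0/1 values, accumulated by recursion on
  the bound.\<close>

lemma decidable_pred_ball[computable_intros]:
  assumes "computable n" "decidable_pred (\<lambda>z. P (p1 z) (p2 z))"
  shows "decidable_pred (\<lambda>x. \<forall>i<n x. P i x)"
proof -
  have "rec_nat 1 (\<lambda>i r. r * of_bool (P i x)) k = (of_bool (\<forall>i<k. P i x) :: nat)" for x k
    by (induction k) (auto simp: less_Suc_eq)
  moreover have "computable (\<lambda>x. rec_nat 1 (\<lambda>i r. r * of_bool (P i x)) (n x))"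
    by (intro computable_rec computable_mult computable_of_bool computable_const assms(1) decidable_pred_pairD[OF assms(2)] computable_intros)
  ultimately show ?thesis by (simp add: decidable_pred_def)
qed

lemma decidable_pred_bex[computable_intros]:
  assumes "computable n" "decidable_pred (\<lambda>z. P (p1 z) (p2 z))"
  shows "decidable_pred (\<lambda>x. \<exists>i<n x. P i x)"
  using decidable_pred_not[OF decidable_pred_ball[OF assms(1) decidable_pred_not[OF assms(2)]]] by simp

lemma decidable_pred_bex_le[computable_intros]:
  assumes "computable n" "decidable_pred (\<lambda>z. P (p1 z) (p2 z))"
  shows "decidable_pred (\<lambda>x. \<exists>i\<le>n x. P i x)"
  using decidable_pred_bex[OF computable_Suc[OF assms(1)] assms(2)] by (simp add: less_Suc_eq_le)

text \<open>The first premise makes the search stop for every parameter, so that minimisation gives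
  a total function.\<close>

lemma computable_Least[computable_intros]:
  assumes "\<And>x. \<exists>n. P n x" "decidable_pred (\<lambda>z. P (p1 z) (p2 z))"
  shows "computable (\<lambda>x. LEAST n. P n x)"
proof -
  obtain p where p: "\<And>z. computes p [z] (of_bool (\<not> P (p1 z) (p2 z)))"
    using decidable_pred_not[OF assms(2)] unfolding decidable_pred_def computable_def by blast
  obtain pp where pp: "\<And>x y. computes pp [x, y] (pr x y)" using computable2_pr computable2_def by auto
  have "computes (Comp p [pp]) [m, x] (of_bool (\<not> P m x))" for m x
    using computes_Comp1[OF pp p] by simp
  then have "computes (Minim (Comp p [pp])) [x] (LEAST n. P n x)" for x
    using computes_Minim[OF _ assms(1)] by blast
  then show ?thesis unfolding computable_def by blast
qed

lemma computable_div[computable_intros]: assumes "computable f" "computable g" shows "computable (\<lambda>x. f x div g x)"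
proof -
  \<comment> \<open>The quotient is the first \<open>k\<close> with \<open>a < b * Suc k\<close>;
    the disjunct \<open>b = 0\<close> stops the search at 0, in accordance with
    \<open>a div 0 = 0\<close>.\<close>
  have "(LEAST k. b = 0 \<or> a < b * Suc k) = a div b" for a b :: nat
  proof (cases "b = 0")
    case False
    show ?thesis
    proof (rule Least_equality)
      show "b = 0 \<or> a < b * Suc (a div b)" using False
        by (metis dividend_less_times_div mult_Suc_right neq0_conv)
      fix k assume "b = 0 \<or> a < b * Suc k"
      then show "a div b \<le> k" using False
        by (simp add: less_mult_imp_div_less less_Suc_eq_le[symmetric] mult.commute)
    qed
  qed simp
  moreover have "computable (\<lambda>x. LEAST k. g x = 0 \<or> f x < g x * Suc k)"
    by (intro computable_Least computable_intros computable_comp[OF assms(1)] computable_comp[OF assms(2)])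
       (metis mult_Suc_right dividend_less_times_div neq0_conv)
  ultimately show ?thesis by simp
qed

lemma computable_mod[computable_intros]: assumes "computable f" "computable g" shows "computable (\<lambda>x. f x mod g x)"
proof -
  have "computable (\<lambda>x. f x - g x * (f x div g x))" by (intro computable_intros assms)
  then show ?thesis by (simp add: minus_mult_div_eq_mod)
qed

section \<open>Lists coded as numbers\<close>

definition lnth :: "nat \<Rightarrow> nat \<Rightarrow> nat" where
  "lnth n i = (if i < length (list_decode n) then list_decode n ! i else 0)"

lemma computable_ldrop: assumes "computable f" "computable g" shows "computable (\<lambda>x. list_encode (drop (f x) (list_decode (g x))))"
proof -
  \<comment> \<open>A nonempty list has a code \<open>Suc (pr x y)\<close> with \<open>y\<close> the
    code of its tail. At 0 the formula returns 0, the code of \<open>tl []\<close>.\<close>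
  have *: "p2 (n - 1) = list_encode (tl (list_decode n))" for n
    by (cases n) (simp, simp add: p2_def split: prod.split)
  have "rec_nat n (\<lambda>i r. p2 (r - 1)) k = list_encode (drop k (list_decode n))" for n k
  proof (induction k)
    case (Suc k)
    then show ?case unfolding * by (simp add: drop_Suc tl_drop)
  qed simp
  moreover have "computable (\<lambda>x. rec_nat (g x) (\<lambda>i r. p2 (r - 1)) (f x))"
    by (intro computable_intros assms)
  ultimately show ?thesis by simp
qed

lemma list_encode_eq_0[simp]: "list_encode xs = 0 \<longleftrightarrow> xs = []"
  by (cases xs) auto

lemma computable_length[computable_intros]: assumes "computable f" shows "computable (\<lambda>x. length (list_decode (f x)))"
proof -
  have "(LEAST k. list_encode (drop k xs) = 0) = length xs" for xs
    by (rule Least_equality) auto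
  moreover have "computable (\<lambda>x. LEAST k. list_encode (drop k (list_decode (f x))) = 0)"
    by (intro computable_Least computable_intros computable_ldrop computable_comp[OF assms]) auto
  ultimately show ?thesis by simp
qed

lemma computable_lnth[computable_intros]: assumes "computable f" "computable g" shows "computable (\<lambda>x. lnth (f x) (g x))"
proof -
  have "p1 (list_encode (drop i (list_decode n)) - 1) = lnth n i" for n i
  proof (cases "i < length (list_decode n)")
    case True
    then show ?thesis by (simp add: lnth_def Cons_nth_drop_Suc[symmetric] p1_def)
  qed (auto simp: lnth_def)
  moreover have "computable (\<lambda>x. p1 (list_encode (drop (g x) (list_decode (f x))) - 1))"
    by (intro computable_intros computable_ldrop assms)
  ultimately show ?thesis by simp
qed

lemma computable_foldr[computable_intros]:
  assumes "computable l" "computable b" "computable (\<lambda>z. h (p1 z) (p1 (p2 z)) (p2 (p2 z)))"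
  shows "computable (\<lambda>x. foldr (\<lambda>y r. h y r x) (list_decode (l x)) (b x))"
proof -
  \<comment> \<open>The recursion runs from the end of the list: after \<open>k\<close> rounds the
    last \<open>k\<close> entries have been folded.\<close>
  have *: "rec_nat b (\<lambda>i r. h (lnth n (length (list_decode n) - Suc i)) r x) k
      = foldr (\<lambda>y r. h y r x) (drop (length (list_decode n) - k) (list_decode n)) b"
    if "k \<le> length (list_decode n)" for n k b x using that
  proof (induction k)
    case (Suc k)
    let ?L = "list_decode n"
    have lt: "length ?L - Suc k < length ?L" "Suc (length ?L - Suc k) = length ?L - k"
      using Suc(2) by auto
    have "drop (length ?L - Suc k) ?L = lnth n (length ?L - Suc k) # drop (length ?L - k) ?L"
      using Cons_nth_drop_Suc[OF lt(1)] lt by (simp add: lnth_def)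
    then show ?case using Suc by simp
  qed simp
  have "computable (\<lambda>x. rec_nat (b x) (\<lambda>i r. h (lnth (l x) (length (list_decode (l x)) - Suc i)) r x) (length (list_decode (l x))))"
  proof (rule computable_rec)
    have "computable (\<lambda>z. h (p1 (f z)) (p1 (p2 (f z))) (p2 (p2 (f z))))" if "computable f" for f
      using computable_comp[OF assms(3) that] .
    from this[of "\<lambda>z. pr (lnth (l (p2 (p2 z))) (length (list_decode (l (p2 (p2 z)))) - Suc (p1 z))) (p2 z)"]
    show "computable (\<lambda>z. h (lnth (l (p2 (p2 z))) (length (list_decode (l (p2 (p2 z)))) - Suc (p1 z))) (p1 (p2 z)) (p2 (p2 z)))"
      by (simp) (erule meta_mp, intro computable_intros computable_comp[OF assms(1)])
  qed (intro computable_intros assms)+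
  then show ?thesis using *[OF le_refl] by simp
qed

text \<open>Conditionals correct one argument at a time, which removes finitely many discrepancies.
  This makes the finite tables of the permutations computable.\<close>

lemma computable_finite_change:
  assumes "computable g" "finite {x. f x \<noteq> g x}" shows "computable f"
  using assms(2,1)
proof (induction "{x. f x \<noteq> g x}" arbitrary: g rule: finite_induct)
  case empty
  then have "f = g" by auto
  then show ?case using empty by simp
next
  case (insert a F)
  let ?g = "\<lambda>x. if x = a then f a else g x"
  have "F = {x. f x \<noteq> ?g x}" using insert(2,4) by auto
  moreover have "computable ?g" by (intro computable_intros computable_comp[OF insert(5)])
  ultimately show ?case by (rule insert(3))
qed

lemma decidable_iff_decidable_pred: "decidable A \<longleftrightarrow> decidable_pred (\<lambda>x. x \<in> A)"
  by (simp add: decidable_def decidable_pred_def computable_def of_bool_def)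

text \<open>The input is read as a pair of a witness and a value. The program returns the value but
  also runs a search whose test ignores the counter, so it halts exactly if the witness is
  good.\<close>

lemma recursively_enumerableI:
  assumes "decidable_pred (\<lambda>z. T (p1 z) (p2 z))" shows "recursively_enumerable {y. \<exists>n. T n y}"
proof -
  obtain p where p: "\<And>z. computes p [z] (of_bool (\<not> T (p1 z) (p2 z)))"
    using decidable_pred_not[OF assms] unfolding decidable_pred_def computable_def by blast
  obtain q where q: "\<And>x. computes q [x] (p2 x)" using computable_p2 computable_def by auto
  let ?m = "Minim (Comp p [Proj 1])"
  let ?f = "Comp (Proj 0) [q, ?m]"
  have pm: "computes (Comp p [Proj 1]) [m, x] (of_bool (\<not> T (p1 x) (p2 x)))" for m x
    by (rule computes_Comp1[OF computes_Proj p]) auto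
  have "(\<exists>n. T n y) \<longleftrightarrow> (\<exists>x. computes ?f [x] y)" for y
  proof
    assume "\<exists>n. T n y"
    then obtain n where n: "T n y" by blast
    have m: "computes ?m [pr n y] (LEAST k. True)"
      by (rule computes_Minim) (use pm[of _ "pr n y"] n in auto)
    have q': "computes q [pr n y] y" using q[of "pr n y"] by simp
    have "computes ?f [pr n y] y"
      by (rule computes_Comp2[OF q' m computes_Proj]) auto
    then show "\<exists>x. computes ?f [x] y" by blast
  next
    assume "\<exists>x. computes ?f [x] y"
    then obtain x where "computes ?f [x] y" by blast
    then obtain ys where ys: "length ys = 2" "computes q [x] (ys ! 0)"
      "computes ?m [x] (ys ! 1)" "computes (Proj 0) ys y"
      by cases (force simp: numeral_2_eq_2 all_less_two)
    from ys(4) have "y = ys ! 0" by cases simp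
    then have "y = p2 x" using ys(2) q computes_unique by blast
    from ys(3) obtain n where "computes (Comp p [Proj 1]) [n, x] 0" by cases blast
    then have "T (p1 x) (p2 x)" using computes_unique[OF pm] by fastforce
    then show "\<exists>n. T n y" using \<open>y = p2 x\<close> by blast
  qed
  then show ?thesis unfolding recursively_enumerable_def by blast
qed


section \<open>An undecidable projection\<close>

lemma list_encode_Cons: "list_encode (x # xs) = Suc (pr x (list_encode xs))"
  by (simp add: pr_def)

declare list_encode.simps(2)[simp del]

section \<open>Goedel numbers of programs and formal derivations\<close>

primrec code :: "recf \<Rightarrow> nat" where
  "code Zero = pr 0 0"
| "code Succ = pr 1 0"
| "code (Proj i) = pr 2 i"
| "code (Comp f gs) = pr 3 (pr (code f) (list_encode (map code gs)))"
| "code (PrimRec f g) = pr 4 (pr (code f) (code g))"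
| "code (Minim f) = pr 5 (code f)"

definition judgement :: "nat \<Rightarrow> nat \<Rightarrow> nat \<Rightarrow> nat" where
  "judgement f xs y = pr f (pr xs y)"

text \<open>\<open>follows b S f xs y\<close>: the judgement on \<open>f\<close>, \<open>xs\<close>, \<open>y\<close> follows from judgements in \<open>S\<close> by a
  rule of \<^const>\<open>computes\<close>.  The bound \<open>b\<close> on the values guessed by the rule makes this
  decidable.\<close>

definition follows :: "nat \<Rightarrow> nat set \<Rightarrow> nat \<Rightarrow> nat \<Rightarrow> nat \<Rightarrow> bool" where
  "follows b S f xs y \<longleftrightarrow>
     f = pr 0 0 \<and> y = 0
   \<or> f = pr 1 0 \<and> 0 < xs \<and> y = Suc (p1 (xs - 1))
   \<or> p1 f = 2 \<and> p2 f < length (list_decode xs) \<and> y = lnth xs (p2 f)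
   \<or> p1 f = 3 \<and> (\<exists>ys\<le>b. length (list_decode ys) = length (list_decode (p2 (p2 f)))
       \<and> (\<forall>k<length (list_decode ys). judgement (lnth (p2 (p2 f)) k) xs (lnth ys k) \<in> S)
       \<and> judgement (p1 (p2 f)) ys y \<in> S)
   \<or> p1 f = 4 \<and> 0 < xs \<and> p1 (xs - 1) = 0 \<and> judgement (p1 (p2 f)) (p2 (xs - 1)) y \<in> S
   \<or> p1 f = 4 \<and> 0 < xs \<and> 0 < p1 (xs - 1) \<and>
       (\<exists>r\<le>b. judgement f (Suc (pr (p1 (xs - 1) - 1) (p2 (xs - 1)))) r \<in> S
         \<and> judgement (p2 (p2 f)) (Suc (pr (p1 (xs - 1) - 1) (Suc (pr r (p2 (xs - 1)))))) y \<in> S)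
   \<or> p1 f = 5 \<and> judgement (p2 f) (Suc (pr y xs)) 0 \<in> S
       \<and> (\<forall>m<y. \<exists>r\<le>b. judgement (p2 f) (Suc (pr m xs)) (Suc r) \<in> S)"

lemma follows_mono:
  assumes "follows b S f xs y" "b \<le> b'" "S \<subseteq> S'" shows "follows b' S' f xs y"
proof -
  have "follows b S f xs y \<longrightarrow> follows b' S' f xs y"
    unfolding follows_def
    by (intro disj_mono conj_mono ex_mono all_mono imp_mono) (use assms(2,3) in auto)
  then show ?thesis using assms(1) by blast
qed

text \<open>Premises stand to the right: each entry follows from later ones, so a new conclusion is
  added at the head. One bound \<open>b\<close> serves the whole list.\<close>

primrec derivation :: "nat \<Rightarrow> nat list \<Rightarrow> bool" where
  "derivation b [] \<longleftrightarrow> True"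
| "derivation b (z # L) \<longleftrightarrow>
     follows b (set L) (p1 z) (p1 (p2 z)) (p2 (p2 z)) \<and> derivation b L"

text \<open>Appending \<open>L'\<close> only adds premises for the entries of \<open>L\<close> and
  leaves those of \<open>L'\<close> unchanged; raising the bound is harmless by
  \<open>follows_mono\<close>.\<close>

lemma derivation_append:
  "derivation b L \<Longrightarrow> derivation b' L' \<Longrightarrow> derivation (max b b') (L @ L')"
proof (induction L)
  case Nil
  then have "derivation b' L' \<Longrightarrow> derivation (max b b') L'"
    by (induction L') (auto intro: follows_mono[of b' _ _ _ _ "max b b'"])
  then show ?case using Nil by simp
qed (auto intro: follows_mono[of b _ _ _ _ "max b b'"])

lemma derivation_iff_nth:
  "derivation b L \<longleftrightarrow> (\<forall>i<length L. follows b (set (drop (Suc i) L))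
     (p1 (L ! i)) (p1 (p2 (L ! i))) (p2 (p2 (L ! i))))"
  by (induction L) (auto simp: All_less_Suc2)

definition derivable :: "nat set" where
  "derivable = {z. \<exists>b L. derivation b L \<and> z \<in> set L}"

lemma finite_derivable:
  "finite S \<Longrightarrow> S \<subseteq> derivable \<Longrightarrow> \<exists>b L. derivation b L \<and> S \<subseteq> set L"
proof (induction rule: finite_induct)
  case empty
  show ?case by (intro exI[of _ "[]"] exI[of _ 0]) simp
next
  case (insert z S)
  then obtain b L b' L' where "derivation b L" "S \<subseteq> set L" "derivation b' L'" "z \<in> set L'"
    unfolding derivable_def by blast
  then show ?case by (intro exI[of _ "max b b'"] exI[of _ "L @ L'"]) (auto intro: derivation_append)
qed

text \<open>The derivations of the finitely many premises are concatenated into one, and the new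
  judgement is put in front.\<close>

lemma derivableI:
  assumes "follows b S f xs y" "finite S" "S \<subseteq> derivable"
  shows "judgement f xs y \<in> derivable"
proof -
  obtain b' L where L: "derivation b' L" "S \<subseteq> set L" using finite_derivable[OF assms(2,3)] by blast
  have "derivation (max b b') ([] @ L)" using derivation_append[of b "[]"] L by simp
  then have "derivation (max b b') (judgement f xs y # L)"
    using follows_mono[OF assms(1) _ L(2), of "max b b'"] by (simp add: judgement_def)
  then show ?thesis unfolding derivable_def
    by (intro CollectI exI conjI) (assumption, rule list.set_intros(1))
qed

lemma lnth_list_encode[simp]: "i < length xs \<Longrightarrow> lnth (list_encode xs) i = xs ! i"
  by (simp add: lnth_def)

lemma computes_derivable:
  "computes f xs y \<Longrightarrow> judgement (code f) (list_encode xs) y \<in> derivable"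
proof (induction rule: computes.induct)
  case (1 xs)
  show ?case by (rule derivableI[of 0 "{}"]) (auto simp: follows_def)
next
  case (2 x xs)
  show ?case unfolding list_encode_Cons
    by (rule derivableI[of 0 "{}"]) (auto simp: follows_def)
next
  case (3 i xs)
  then show ?case by (intro derivableI[of 0 "{}"]) (auto simp: follows_def)
next
  case (4 ys gs xs f z)
  let ?S = "insert (judgement (code f) (list_encode ys) z)
    ((\<lambda>k. judgement (code (gs ! k)) (list_encode xs) (ys ! k)) ` {..<length gs})"
  have "follows (list_encode ys) ?S (code (Comp f gs)) (list_encode xs) z"
    unfolding follows_def using "4.hyps"
    by (auto intro!: exI[of _ "list_encode ys"])
  then show ?case by (rule derivableI) (use "4.IH" in auto)
next
  case (5 f xs y g)
  let ?S = "{judgement (code f) (list_encode xs) y}"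
  have "follows 0 ?S (code (PrimRec f g)) (list_encode (0 # xs)) y"
    unfolding follows_def list_encode_Cons by simp
  then show ?case by (rule derivableI) (use "5.IH" in auto)
next
  case (6 f g n xs y z)
  let ?S = "{judgement (code (PrimRec f g)) (list_encode (n # xs)) y,
    judgement (code g) (list_encode (n # y # xs)) z}"
  have "follows y ?S (code (PrimRec f g)) (list_encode (Suc n # xs)) z"
    unfolding follows_def list_encode_Cons by auto
  then show ?case by (rule derivableI) (use "6.IH" in auto)
next
  case (7 f n xs)
  then obtain r where r: "\<And>m. m < n \<Longrightarrow> judgement (code f) (list_encode (m # xs)) (Suc (r m)) \<in> derivable"
    by metis
  let ?S = "insert (judgement (code f) (list_encode (n # xs)) 0)
    ((\<lambda>m. judgement (code f) (list_encode (m # xs)) (Suc (r m))) ` {..<n})"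
  \<comment> \<open>Minimisation guesses a value for each \<open>m < n\<close>; their sum is a
    common bound.\<close>
  have "r m \<le> sum r {..<n}" if "m < n" for m using that by (intro member_le_sum) auto
  then have "follows (sum r {..<n}) ?S (code (Minim f)) (list_encode xs) n"
    unfolding follows_def list_encode_Cons by (auto; blast)
  then show ?case by (rule derivableI) (use "7.IH" r in auto)
qed

text \<open>Inverts the coded rules into those of \<open>computes\<close>, case by case on the
  program. The premise on \<open>S\<close> is the induction hypothesis for the rest of a
  derivation.\<close>

lemma follows_sound:
  assumes "follows b S (code f) (list_encode xs) y"
    and S: "\<And>g zs r. judgement (code g) (list_encode zs) r \<in> S \<Longrightarrow> computes g zs r"
  shows "computes f xs y"
proof (cases f)
  case Zero
  then show ?thesis using assms by (auto simp: follows_def intro: computes.intros)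
next
  case Succ
  then show ?thesis using assms
    by (cases xs) (auto simp: follows_def list_encode_Cons intro: computes.intros)
next
  case (Proj i)
  then show ?thesis using assms
    by (auto simp: follows_def intro: computes_Proj)
next
  case (Comp g gs)
  then obtain c where c: "length (list_decode c) = length gs"
    "\<And>k. k < length gs \<Longrightarrow> judgement (code (gs ! k)) (list_encode xs) (lnth c k) \<in> S"
    "judgement (code g) c y \<in> S"
    using assms(1) by (auto simp: follows_def)
  define ys where "ys = list_decode c"
  have c': "c = list_encode ys" by (simp add: ys_def)
  show ?thesis unfolding Comp
    by (rule computes.intros(4)[where ys = ys]) (use c in \<open>auto simp: c' intro!: S\<close>)
next
  case (PrimRec g h)
  show ?thesis
  proof (cases xs)
    case Nil
    then show ?thesis using assms(1) PrimRec by (simp add: follows_def)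
  next
    case (Cons n zs)
    show ?thesis
    proof (cases n)
      case 0
      then have "judgement (code g) (list_encode zs) y \<in> S"
        using assms(1) unfolding Cons PrimRec list_encode_Cons follows_def by simp
      then show ?thesis unfolding PrimRec Cons 0 by (intro computes.intros S)
    next
      case (Suc m)
      then obtain r where
        "judgement (code (PrimRec g h)) (list_encode (m # zs)) r \<in> S"
        "judgement (code h) (list_encode (m # r # zs)) y \<in> S"
        using assms(1) unfolding Cons PrimRec list_encode_Cons follows_def by auto
      then show ?thesis unfolding PrimRec Cons Suc by (intro computes.intros(6) S)
    qed
  qed
next
  case (Minim g)
  then have "judgement (code g) (list_encode (y # xs)) 0 \<in> S"
    "\<forall>m<y. \<exists>r. judgement (code g) (list_encode (m # xs)) (Suc r) \<in> S"
    using assms(1) unfolding list_encode_Cons follows_def by auto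
  then show ?thesis unfolding Minim by (intro computes.intros(7)) (auto intro: S)
qed

lemma derivable_iff_computes:
  "judgement (code f) (list_encode xs) y \<in> derivable \<longleftrightarrow> computes f xs y"
proof
  assume "judgement (code f) (list_encode xs) y \<in> derivable"
  then obtain b L where "derivation b L" "judgement (code f) (list_encode xs) y \<in> set L"
    by (auto simp: derivable_def)
  then show "computes f xs y"
  proof (induction L arbitrary: f xs y)
    case (Cons z L)
    then show ?case
    proof (cases "z = judgement (code f) (list_encode xs) y")
      case True
      then have "follows b (set L) (code f) (list_encode xs) y"
        using Cons(2) by (simp add: judgement_def)
      then show ?thesis by (rule follows_sound) (use Cons in auto)
    qed (use Cons in auto)
  qed simp
qed (rule computes_derivable)

lemma decidable_pred_mem_drop[computable_intros]:
  assumes "computable f" "computable g" "computable h"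
  shows "decidable_pred (\<lambda>x. h x \<in> set (drop (g x) (list_decode (f x))))"
proof -
  have "z \<in> set (drop k (list_decode n)) \<longleftrightarrow> (\<exists>j<length (list_decode n). k \<le> j \<and> lnth n j = z)" for z k n
  proof
    assume "z \<in> set (drop k (list_decode n))"
    then obtain i where "i < length (list_decode n) - k" "list_decode n ! (k + i) = z"
      by (auto simp: in_set_conv_nth)
    then show "\<exists>j<length (list_decode n). k \<le> j \<and> lnth n j = z"
      by (intro exI[of _ "k + i"]) (auto simp: lnth_def)
  next
    assume "\<exists>j<length (list_decode n). k \<le> j \<and> lnth n j = z"
    then obtain j where j: "j < length (list_decode n)" "k \<le> j" "lnth n j = z" by blast
    then have "drop k (list_decode n) ! (j - k) = z" "j - k < length (drop k (list_decode n))"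
      by (auto simp: lnth_def)
    then show "z \<in> set (drop k (list_decode n))" by (metis nth_mem)
  qed
  moreover have "decidable_pred (\<lambda>x. \<exists>j<length (list_decode (f x)). g x \<le> j \<and> lnth (f x) j = h x)"
    by (intro computable_intros computable_comp[OF assms(1)] computable_comp[OF assms(2)] computable_comp[OF assms(3)] assms)
  ultimately show ?thesis by simp
qed

text \<open>In terms of positions in the list every quantifier is bounded: by a length, by the guess
  bound or by a value.\<close>

lemma decidable_pred_derivation: "decidable_pred (\<lambda>z. derivation (p1 z) (list_decode (p2 z)))"
proof -
  have *: "derivation b (list_decode n) \<longleftrightarrow> (\<forall>i<length (list_decode n).
    follows b (set (drop (Suc i) (list_decode n)))
      (p1 (lnth n i)) (p1 (p2 (lnth n i))) (p2 (p2 (lnth n i))))" for b n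
    by (auto simp: derivation_iff_nth lnth_def)
  show ?thesis unfolding * follows_def judgement_def by (intro computable_intros)
qed

text \<open>Diagonalisation: \<open>n\<close> codes a bound and a derivation that program
  \<open>x\<close> returns 0 on input \<open>x\<close>. A decider, run on its own code, would return
  0 exactly if it does not.\<close>

theorem undecidable_projection:
  obtains T where "decidable_pred (\<lambda>z. T (p1 z) (p2 z))" "\<not> decidable_pred (\<lambda>x. \<exists>n. T n x)"
proof
  define T where "T n x \<longleftrightarrow> derivation (p1 n) (list_decode (p2 n)) \<and>
    judgement x (list_encode [x]) 0 \<in> set (drop 0 (list_decode (p2 n)))" for n x
  show "decidable_pred (\<lambda>z. T (p1 z) (p2 z))"
    unfolding T_def judgement_def list_encode_Cons
    by (intro computable_intros decidable_pred_comp[OF decidable_pred_derivation] decidable_pred_comp[OF decidable_pred_derivation, of "\<lambda>x. p1 x", simplified])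
  show "\<not> decidable_pred (\<lambda>x. \<exists>n. T n x)"
  proof
    assume "decidable_pred (\<lambda>x. \<exists>n. T n x)"
    moreover have "(\<exists>n. T n x) \<longleftrightarrow> judgement x (list_encode [x]) 0 \<in> derivable" for x
    proof
      assume "judgement x (list_encode [x]) 0 \<in> derivable"
      then obtain b L where "derivation b L" "judgement x (list_encode [x]) 0 \<in> set L"
        by (auto simp: derivable_def)
      then show "\<exists>n. T n x" by (intro exI[of _ "pr b (list_encode L)"]) (simp add: T_def)
    qed (auto simp: T_def derivable_def)
    ultimately obtain p where
      p: "\<And>x. computes p [x] (of_bool (judgement x (list_encode [x]) 0 \<in> derivable))"
      by (auto simp: decidable_pred_def computable_def)
    have "computes p [code p] 0 \<longleftrightarrow> judgement (code p) (list_encode [code p]) 0 \<in> derivable"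
      by (rule derivable_iff_computes[symmetric])
    then show False using p[of "code p"] by (auto dest: computes_unique)
  qed
qed


section \<open>Words in the free group\<close>

definition word_inv :: "'s gword \<Rightarrow> 's gword" where
  "word_inv w = rev (map letter_inv w)"

lemma letter_inv_letter_inv[simp]: "letter_inv (letter_inv a) = a"
  by (cases a) auto

lemma sym_free_rel: "sym free_rel"
  unfolding free_rel_def by (intro sym_rtrancl sym_Un_converse)

lemma equiv_free_rel: "equiv UNIV free_rel"
  unfolding equiv_def using sym_free_rel
  by (auto simp: free_rel_def refl_rtrancl trans_rtrancl)

lemma free_step_context: "(u, v) \<in> free_step \<Longrightarrow> (x @ u @ y, x @ v @ y) \<in> free_step"
  unfolding free_step_def by clarsimp (metis append.assoc append_Cons)

lemma free_rel_context: "(u, v) \<in> free_rel \<Longrightarrow> (x @ u @ y, x @ v @ y) \<in> free_rel"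
  unfolding free_rel_def
proof (induction rule: rtrancl_induct)
  case (step v w)
  then have "(x @ v @ y, x @ w @ y) \<in> free_step \<union> free_step\<inverse>"
    using free_step_context by blast
  then show ?case using step(3) by (rule rtrancl_into_rtrancl[rotated])
qed simp

lemma free_rel_append:
  assumes "(u, u') \<in> free_rel" "(v, v') \<in> free_rel" shows "(u @ v, u' @ v') \<in> free_rel"
  using free_rel_context[OF assms(1), of "[]" v] free_rel_context[OF assms(2), of u' "[]"]
  by (auto simp: free_rel_def)

lemma free_rel_cancel: "(word_inv w @ w, []) \<in> free_rel"
proof (induction w)
  case (Cons a w)
  have "(letter_inv a # letter_inv (letter_inv a) # w, w) \<in> free_step"
    unfolding free_step_def
    by (intro CollectI exI[of _ "[]"] exI[of _ "letter_inv a"] exI[of _ w]) simp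
  from free_step_context[OF this, of "word_inv w" "[]"]
  have "(word_inv (a # w) @ a # w, word_inv w @ w) \<in> free_rel"
    by (auto simp: word_inv_def free_rel_def)
  then show ?case using Cons by (auto simp: free_rel_def)
qed (simp add: word_inv_def free_rel_def)

lemma free_class_eq_iff: "free_class u = free_class v \<longleftrightarrow> (u, v) \<in> free_rel"
  unfolding free_class_def by (rule eq_equiv_class_iff[OF equiv_free_rel UNIV_I UNIV_I])

lemma carrier_free_group: "carrier free_group = range free_class"
  by (auto simp: free_group_def quotient_def free_class_def)

lemma free_class_mult:
  fixes u v :: "'s gword"
  shows "free_class u \<otimes>\<^bsub>free_group\<^esub> free_class v = free_class (u @ v)"
proof -
  have *: "free_class (u' @ v') = free_class (u @ v)" if "u' \<in> free_class u" "v' \<in> free_class v" for u' v'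
    using that free_rel_append[of u u' v v'] symD[OF sym_free_rel] unfolding free_class_eq_iff
    by (simp add: free_class_def)
  have "(\<Union>x\<in>free_class u. \<Union>y\<in>free_class v. free_class (x @ y))
      = (\<Union>x\<in>free_class u. \<Union>y\<in>free_class v. free_class (u @ v))"
    by (intro SUP_cong refl *)
  also have "\<dots> = free_class (u @ v)"
    by (auto simp: free_class_def free_rel_def)
  finally show ?thesis by (simp add: free_group_def)
qed

lemma one_free_group: "\<one>\<^bsub>free_group\<^esub> = free_class []"
  by (simp add: free_group_def)

lemma group_free_group: "group (free_group :: 's gword set monoid)"
proof (rule groupI)
  fix x :: "'s gword set" assume "x \<in> carrier free_group"
  then obtain w where w: "x = free_class w" by (auto simp: carrier_free_group)
  have "free_class (word_inv w) \<otimes>\<^bsub>free_group\<^esub> x = \<one>\<^bsub>free_group\<^esub>"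
    using free_rel_cancel by (simp add: w free_class_mult one_free_group free_class_eq_iff)
  then show "\<exists>y\<in>carrier free_group. y \<otimes>\<^bsub>free_group\<^esub> x = \<one>\<^bsub>free_group\<^esub>"
    by (auto simp: carrier_free_group)
qed (clarsimp simp: carrier_free_group free_class_mult one_free_group)+

section \<open>Evaluation of words in an arbitrary group\<close>

context group
begin

definition letter_eval :: "('s \<Rightarrow> 'a) \<Rightarrow> 's + 's \<Rightarrow> 'a" where
  "letter_eval \<sigma> a = (case a of Inl s \<Rightarrow> \<sigma> s | Inr s \<Rightarrow> inv (\<sigma> s))"

definition word_eval :: "('s \<Rightarrow> 'a) \<Rightarrow> 's gword \<Rightarrow> 'a" where
  "word_eval \<sigma> w = foldr (\<lambda>a r. letter_eval \<sigma> a \<otimes> r) w \<one>"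

lemma word_eval_Nil[simp]: "word_eval \<sigma> [] = \<one>"
  by (simp add: word_eval_def)

lemma word_eval_Cons[simp]: "word_eval \<sigma> (a # w) = letter_eval \<sigma> a \<otimes> word_eval \<sigma> w"
  by (simp add: word_eval_def)

context
  fixes \<sigma> :: "'s \<Rightarrow> 'a"
  assumes \<sigma>: "\<And>s. \<sigma> s \<in> carrier G"
begin

lemma letter_eval_closed[simp]: "letter_eval \<sigma> a \<in> carrier G"
  using \<sigma> by (simp add: letter_eval_def split: sum.split)

lemma word_eval_closed[simp]: "word_eval \<sigma> w \<in> carrier G"
  by (induction w) auto

lemma word_eval_append: "word_eval \<sigma> (u @ v) = word_eval \<sigma> u \<otimes> word_eval \<sigma> v"
  by (induction u) (auto simp: m_assoc)

lemma letter_eval_inv: "letter_eval \<sigma> (letter_inv a) = inv (letter_eval \<sigma> a)"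
  using \<sigma> by (cases a) (auto simp: letter_eval_def)

lemma word_eval_free_rel: "(u, v) \<in> free_rel \<Longrightarrow> word_eval \<sigma> u = word_eval \<sigma> v"
  unfolding free_rel_def
proof (induction rule: rtrancl_induct)
  case (step v w)
  have "word_eval \<sigma> x = word_eval \<sigma> y" if "(x, y) \<in> free_step" for x y
    using that by (auto simp: free_step_def word_eval_append letter_eval_inv m_assoc[symmetric])
  then show ?case using step by auto
qed simp

text \<open>Words of one class have the same value by \<open>word_eval_free_rel\<close>, so the
  image of a class is a singleton.\<close>

definition class_eval :: "'s gword set \<Rightarrow> 'a" where
  "class_eval A = the_elem (word_eval \<sigma> ` A)"

lemma class_eval_free_class[simp]: "class_eval (free_class w) = word_eval \<sigma> w"
proof -
  have "word_eval \<sigma> ` free_class w = {word_eval \<sigma> w}"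
    using word_eval_free_rel by (auto simp: free_class_def free_rel_def)
  then show ?thesis by (simp add: class_eval_def)
qed

lemma class_eval_group_hom: "group_hom free_group G class_eval"
  by (rule group_hom.intro[OF group_free_group is_group group_hom_axioms.intro], rule homI)
     (auto simp: carrier_free_group free_class_mult word_eval_append)

lemma subgroup_range_word_eval: "subgroup (range (word_eval \<sigma>)) G"
proof -
  have "class_eval ` carrier free_group = range (word_eval \<sigma>)"
    by (auto simp: carrier_free_group image_iff)
  then show ?thesis using group_hom.img_is_subgroup[OF class_eval_group_hom] by simp
qed

text \<open>The classes of all words of value 1 already form the kernel of evaluation, which is
  normal and thus its own normal closure.\<close>

lemma relators_word_eval: "relators {w. word_eval \<sigma> w = \<one>} = kernel free_group G class_eval"
proof -
  have *: "free_class ` {w. word_eval \<sigma> w = \<one>} = kernel free_group G class_eval"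
    by (auto simp: kernel_def carrier_free_group)
  have "kernel free_group G class_eval \<lhd> free_group"
    by (rule group_hom.normal_kernel[OF class_eval_group_hom])
  then show ?thesis unfolding relators_def normal_closure_def * by blast
qed

text \<open>The first isomorphism theorem for evaluation, with the subgroup generated by the values
  of the letters as target.\<close>

theorem presented_group_word_eval:
  "presented_group {w. word_eval \<sigma> w = \<one>} \<cong> G\<lparr>carrier := range (word_eval \<sigma>)\<rparr>"
proof -
  let ?H = "G\<lparr>carrier := range (word_eval \<sigma>)\<rparr>"
  have H: "group ?H" by (rule subgroup.subgroup_is_group[OF subgroup_range_word_eval is_group])
  have "group_hom free_group ?H class_eval"
    by (rule group_hom.intro[OF group_free_group H group_hom_axioms.intro], rule homI)
       (auto simp: carrier_free_group free_class_mult word_eval_append)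
  moreover have "class_eval ` carrier free_group = carrier ?H"
    by (auto simp: carrier_free_group image_iff)
  ultimately have "free_group Mod kernel free_group ?H class_eval \<cong> ?H"
    by (rule group_hom.FactGroup_iso)
  then show ?thesis unfolding presented_group_def relators_word_eval by (simp add: kernel_def)
qed

text \<open>A coset is trivial exactly if its representative lies in the kernel. The word problem
  thus asks for membership in the set of relators itself.\<close>

lemma word_value_word_eval:
  "word_value {w. word_eval \<sigma> w = \<one>} w = \<one>\<^bsub>presented_group {w. word_eval \<sigma> w = \<one>}\<^esub>
    \<longleftrightarrow> word_eval \<sigma> w = \<one>"
proof -
  let ?K = "kernel free_group G class_eval"
  interpret F: group free_group by (rule group_free_group)
  have "subgroup ?K free_group"
    by (rule group_hom.subgroup_kernel[OF class_eval_group_hom])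
  then have "?K #>\<^bsub>free_group\<^esub> free_class w = ?K \<longleftrightarrow> free_class w \<in> ?K"
    using F.coset_join1[of ?K "free_class w"] F.coset_join2[of "free_class w" ?K]
    by (auto simp: carrier_free_group)
  then show ?thesis unfolding word_value_def presented_group_def relators_word_eval FactGroup_def
    by (simp add: kernel_def carrier_free_group)
qed

end

end


section \<open>Direct limits inside a group\<close>

text \<open>The groups \<open>G n\<close> are embedded in one ambient group compatibly with the maps
  \<open>\<psi> n\<close>, so that the abstract direct limit can be replaced by an increasing union
  of subgroups.\<close>

locale realised_sequence = group H for H :: "('h, 'm) monoid_scheme" (structure) +
  fixes G :: "nat \<Rightarrow> 'g monoid" and \<psi> :: "nat \<Rightarrow> 'g \<Rightarrow> 'g" and \<rho> :: "nat \<Rightarrow> 'g \<Rightarrow> 'h"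
  assumes groups: "group (G n)"
    and \<rho>_hom: "\<rho> n \<in> hom (G n) H"
    and \<rho>_inj: "inj_on (\<rho> n) (carrier (G n))"
    and \<psi>_closed: "g \<in> carrier (G n) \<Longrightarrow> \<psi> n g \<in> carrier (G (Suc n))"
    and \<rho>_\<psi>: "g \<in> carrier (G n) \<Longrightarrow> \<rho> (Suc n) (\<psi> n g) = \<rho> n g"
begin

lemma transition:
  assumes "g \<in> carrier (G m)"
  shows "transition \<psi> m k g \<in> carrier (G (m + k)) \<and> \<rho> (m + k) (transition \<psi> m k g) = \<rho> m g"
  by (induction k) (use assms in \<open>auto simp: \<psi>_closed \<rho>_\<psi>\<close>)

lemma transition_le:
  assumes "g \<in> carrier (G m)" "m \<le> n"
  shows "transition \<psi> m (n - m) g \<in> carrier (G n)" "\<rho> n (transition \<psi> m (n - m) g) = \<rho> m g"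
  using transition[OF assms(1), of "n - m"] assms(2) by auto

abbreviation realise :: "nat \<times> 'g \<Rightarrow> 'h" where "realise p \<equiv> \<rho> (fst p) (snd p)"

text \<open>Transitions preserve realisations, which gives one direction; for the other, both points
  are moved to the index \<open>m + n\<close>, where \<open>\<rho>\<close> is injective.\<close>

lemma limit_rel_eq:
  "limit_rel G \<psi> = {(p, q). p \<in> limit_points G \<and> q \<in> limit_points G \<and> realise p = realise q}"
proof -
  have iff: "(\<exists>k l. m + k = n + l \<and> transition \<psi> m k g = transition \<psi> n l h) \<longleftrightarrow> \<rho> m g = \<rho> n h"
    if "g \<in> carrier (G m)" "h \<in> carrier (G n)" for m n g h
  proof
    assume "\<exists>k l. m + k = n + l \<and> transition \<psi> m k g = transition \<psi> n l h"
    then show "\<rho> m g = \<rho> n h" using transition that by metis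
  next
    assume *: "\<rho> m g = \<rho> n h"
    have mn: "m + n = n + m" by simp
    have "transition \<psi> m n g = transition \<psi> n m h"
      using transition[OF that(1), of n] transition[OF that(2), of m] *
      by (intro inj_onD[OF \<rho>_inj[of "m + n"]]) (auto simp: mn)
    then show "\<exists>k l. m + k = n + l \<and> transition \<psi> m k g = transition \<psi> n l h"
      using mn by blast
  qed
  show ?thesis
    unfolding limit_rel_def limit_points_def
    by (intro Collect_cong) (simp add: iff split: prod.split cong: conj_cong)
qed

lemma limit_mult:
  assumes "p \<in> limit_points G" "q \<in> limit_points G"
  shows "limit_mult G \<psi> p q \<in> limit_points G"
    "realise (limit_mult G \<psi> p q) = realise p \<otimes> realise q"
proof -
  obtain m g n h where pq: "p = (m, g)" "q = (n, h)" by fastforce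
  let ?k = "max m n"
  interpret K: group "G ?k" by (rule groups)
  have g: "g \<in> carrier (G m)" and h: "h \<in> carrier (G n)" using assms pq by (auto simp: limit_points_def)
  note g' = transition_le[OF g max.cobounded1[of m n]] and h' = transition_le[OF h max.cobounded2[of n m]]
  show "limit_mult G \<psi> p q \<in> limit_points G"
    using g' h' by (simp add: pq limit_mult_def limit_points_def)
  show "realise (limit_mult G \<psi> p q) = realise p \<otimes> realise q"
    using g' h' hom_mult[OF \<rho>_hom[of ?k]] by (simp add: pq limit_mult_def)
qed

lemma \<rho>_image_mono: "m \<le> n \<Longrightarrow> \<rho> m ` carrier (G m) \<subseteq> \<rho> n ` carrier (G n)"
  using transition_le by (auto intro!: rev_image_eqI)

definition limit_image :: "'h set" where "limit_image = (\<Union>n. \<rho> n ` carrier (G n))"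

lemma subgroup_limit_image: "subgroup limit_image H"
proof (rule subgroupI)
  have sub: "subgroup (\<rho> n ` carrier (G n)) H" for n
    using group_hom.img_is_subgroup[OF group_hom.intro[OF groups is_group group_hom_axioms.intro[OF \<rho>_hom]]] .
  show "limit_image \<subseteq> carrier H" using subgroup.subset[OF sub] by (auto simp: limit_image_def)
  show "limit_image \<noteq> {}" unfolding limit_image_def using subgroup.one_closed[OF sub[of 0]] by (metis UN_I UNIV_I emptyE)
  fix x assume x: "x \<in> limit_image"
  then obtain m where m: "x \<in> \<rho> m ` carrier (G m)" by (auto simp: limit_image_def)
  show "inv x \<in> limit_image" using subgroup.m_inv_closed[OF sub m] by (auto simp: limit_image_def)
  fix y assume "y \<in> limit_image"
  then obtain n where n: "y \<in> \<rho> n ` carrier (G n)" by (auto simp: limit_image_def)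
  have "x \<otimes> y \<in> \<rho> (max m n) ` carrier (G (max m n))"
    using m n \<rho>_image_mono[of m "max m n"] \<rho>_image_mono[of n "max m n"]
    by (intro subgroup.m_closed[OF sub]) auto
  then show "x \<otimes> y \<in> limit_image" by (auto simp: limit_image_def)
qed

text \<open>Each element of the union is sent to the set of points realising it. By
  \<open>limit_rel_eq\<close> these fibres are exactly the classes of the limit.\<close>

theorem direct_limit_iso: "H\<lparr>carrier := limit_image\<rparr> \<cong> direct_limit G \<psi>"
proof -
  define \<Lambda> where "\<Lambda> f = {p \<in> limit_points G. realise p = f}" for f
  have U: "limit_image = realise ` limit_points G"
    by (force simp: limit_image_def limit_points_def)
  have cls: "limit_rel G \<psi> `` {p} = \<Lambda> (realise p)" if "p \<in> limit_points G" for p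
    using that by (auto simp: limit_rel_eq \<Lambda>_def)
  have car: "carrier (direct_limit G \<psi>) = \<Lambda> ` limit_image"
    unfolding U by (simp add: direct_limit_def quotient_def cls image_image UNION_singleton_eq_range)
  have ne: "\<Lambda> f \<noteq> {}" if "f \<in> limit_image" for f
    using that unfolding \<Lambda>_def U by blast
  have "inj_on \<Lambda> limit_image"
    by (rule inj_onI) (auto simp: \<Lambda>_def U)
  moreover have "\<Lambda> (f \<otimes> g) = \<Lambda> f \<otimes>\<^bsub>direct_limit G \<psi>\<^esub> \<Lambda> g" if "f \<in> limit_image" "g \<in> limit_image" for f g
  proof -
    have "(\<Union>p\<in>\<Lambda> f. \<Union>q\<in>\<Lambda> g. limit_rel G \<psi> `` {limit_mult G \<psi> p q})
        = (\<Union>p\<in>\<Lambda> f. \<Union>q\<in>\<Lambda> g. \<Lambda> (f \<otimes> g))"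
      by (intro SUP_cong refl) (auto simp: \<Lambda>_def cls limit_mult)
    also have "\<dots> = \<Lambda> (f \<otimes> g)"
      using ne[OF that(1)] ne[OF that(2)] by auto
    finally show ?thesis by (simp add: direct_limit_def)
  qed
  ultimately have "\<Lambda> \<in> iso (H\<lparr>carrier := limit_image\<rparr>) (direct_limit G \<psi>)"
    by (auto simp: iso_def hom_def bij_betw_def car)
  then show ?thesis by (auto simp: is_iso_def)
qed

end


section \<open>The action of the iterated wreath products\<close>

locale finite_perm_group =
  fixes X :: "'a set" and P :: "('a \<Rightarrow> 'a) set"
  assumes finite_X: "finite X" and X_nonempty: "X \<noteq> {}" and P_subgroup: "subgroup P (BijGroup X)"
begin

abbreviation "C \<equiv> perm_group X P"
abbreviation "W n \<equiv> iter_wreath X P n"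

lemma P_Bij: "p \<in> P \<Longrightarrow> p \<in> Bij X"
  using subgroup.subset[OF P_subgroup] by (auto simp: BijGroup_def)

lemma group_C: "group C"
  unfolding perm_group_def by (rule subgroup.subgroup_is_group[OF P_subgroup group_BijGroup])

lemma carrier_C[simp]: "carrier C = P"
  by (simp add: perm_group_def)

lemma P_closed: "p \<in> P \<Longrightarrow> x \<in> X \<Longrightarrow> p x \<in> X"
  using P_Bij Bij_imp_funcset by blast

lemma C_mult: "p \<in> P \<Longrightarrow> r \<in> P \<Longrightarrow> x \<in> X \<Longrightarrow> (p \<otimes>\<^bsub>C\<^esub> r) x = p (r x)"
  by (simp add: perm_group_def BijGroup_def P_Bij compose_def)

lemma C_one: "x \<in> X \<Longrightarrow> \<one>\<^bsub>C\<^esub> x = x"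
  by (simp add: perm_group_def BijGroup_def)

lemma C_inv: "p \<in> P \<Longrightarrow> x \<in> X \<Longrightarrow> (inv\<^bsub>C\<^esub> p) (p x) = x"
  using C_mult[of "inv\<^bsub>C\<^esub> p" p x] group.l_inv[OF group_C, of p] group.inv_closed[OF group_C, of p]
  by (simp add: C_one)

lemma C_closed: "p \<in> P \<Longrightarrow> r \<in> P \<Longrightarrow> p \<otimes>\<^bsub>C\<^esub> r \<in> P" "\<one>\<^bsub>C\<^esub> \<in> P" "p \<in> P \<Longrightarrow> inv\<^bsub>C\<^esub> p \<in> P"
  using monoid.m_closed[OF group.is_monoid[OF group_C]] monoid.one_closed[OF group.is_monoid[OF group_C]]
    group.inv_closed[OF group_C] by auto

lemma P_ext: "p \<in> P \<Longrightarrow> r \<in> P \<Longrightarrow> (\<And>x. x \<in> X \<Longrightarrow> p x = r x) \<Longrightarrow> p = r"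
  using P_Bij Bij_imp_extensional by (blast intro: extensionalityI)

lemma points_0[simp]: "points X 0 = {[]}"
  by (auto simp: points_def)

lemma points_Suc: "points X (Suc n) = {x # v | x v. x \<in> X \<and> v \<in> points X n}"
  by (auto simp: points_def length_Suc_conv)

lemma carrier_W_Suc:
  "carrier (W (Suc n)) = {b # g | b g. b \<in> (\<Pi>\<^sub>E v\<in>points X n. P) \<and> g \<in> carrier (W n)}"
  by (simp add: semidirect_def base_group_def)

lemma mult_W_Suc:
  "(b # g) \<otimes>\<^bsub>W (Suc n)\<^esub> (c # h) =
    (\<lambda>v\<in>points X n. b v \<otimes>\<^bsub>C\<^esub> c (wr_act (inv\<^bsub>W n\<^esub> g) v)) # (g \<otimes>\<^bsub>W n\<^esub> h)"
  by (auto simp: semidirect_def base_group_def cong: restrict_cong)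

lemma one_W_Suc: "\<one>\<^bsub>W (Suc n)\<^esub> = (\<lambda>v\<in>points X n. \<one>\<^bsub>C\<^esub>) # \<one>\<^bsub>W n\<^esub>"
  by (simp add: semidirect_def base_group_def)

declare iter_wreath.simps(2)[simp del]

text \<open>Multiplication in \<open>W (Suc n)\<close> uses the action of \<open>W n\<close>, so
  group axioms, action laws and faithfulness pass through the induction together.\<close>

definition acts :: "nat \<Rightarrow> bool" where
  "acts n \<longleftrightarrow> group (W n) \<and>
    (\<forall>g\<in>carrier (W n). \<forall>v\<in>points X n. wr_act g v \<in> points X n) \<and>
    (\<forall>v\<in>points X n. wr_act \<one>\<^bsub>W n\<^esub> v = v) \<and>
    (\<forall>g\<in>carrier (W n). \<forall>h\<in>carrier (W n). \<forall>v\<in>points X n.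
       wr_act (g \<otimes>\<^bsub>W n\<^esub> h) v = wr_act g (wr_act h v)) \<and>
    (\<forall>g\<in>carrier (W n). \<forall>h\<in>carrier (W n). (\<forall>v\<in>points X n. wr_act g v = wr_act h v) \<longrightarrow> g = h)"

text \<open>Once products and the identity are seen to act correctly, faithfulness reduces the group
  laws of \<open>W (Suc n)\<close> to laws of composition of maps.\<close>

lemma acts: "acts n"
proof (induction n)
  case 0
  have "group (W 0)" by (rule groupI) auto
  then show ?case by (simp add: acts_def)
next
  case (Suc n)
  interpret Wn: group "W n" using Suc by (simp add: acts_def)
  have closed: "wr_act g v \<in> points X n" if "g \<in> carrier (W n)" "v \<in> points X n" for g v
    using Suc that by (simp add: acts_def)
  have one: "wr_act \<one>\<^bsub>W n\<^esub> v = v" if "v \<in> points X n" for v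
    using Suc that by (simp add: acts_def)
  have mult: "wr_act (g \<otimes>\<^bsub>W n\<^esub> h) v = wr_act g (wr_act h v)"
    if "g \<in> carrier (W n)" "h \<in> carrier (W n)" "v \<in> points X n" for g h v
    using Suc that by (simp add: acts_def)
  have faith: "g = h" if "g \<in> carrier (W n)" "h \<in> carrier (W n)"
    "\<And>v. v \<in> points X n \<Longrightarrow> wr_act g v = wr_act h v" for g h
    using Suc that unfolding acts_def by blast
  have inv1: "wr_act (inv\<^bsub>W n\<^esub> g) (wr_act g v) = v" and inv2: "wr_act g (wr_act (inv\<^bsub>W n\<^esub> g) v) = v"
    if "g \<in> carrier (W n)" "v \<in> points X n" for g v
    using mult[of "inv\<^bsub>W n\<^esub> g" g v] mult[of g "inv\<^bsub>W n\<^esub> g" v] that one by auto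
  let ?B = "\<Pi>\<^sub>E v\<in>points X n. P"
  have elim: "\<exists>b g. z = b # g \<and> b \<in> ?B \<and> g \<in> carrier (W n)" if "z \<in> carrier (W (Suc n))" for z
    using that unfolding carrier_W_Suc by blast
  have intro: "b # g \<in> carrier (W (Suc n))" if "b \<in> ?B" "g \<in> carrier (W n)" for b g
    using that unfolding carrier_W_Suc by blast
  have closedS: "wr_act z v \<in> points X (Suc n)" if zv: "z \<in> carrier (W (Suc n))" "v \<in> points X (Suc n)" for z v
  proof -
    obtain b g x u where "z = b # g" "b \<in> ?B" "g \<in> carrier (W n)" "v = x # u" "x \<in> X" "u \<in> points X n"
      using elim[OF zv(1)] zv(2) unfolding points_Suc by blast
    then show ?thesis using closed[of g u] PiE_mem[of b "points X n" "\<lambda>_. P" "wr_act g u"]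
      by (simp add: points_Suc P_closed)
  qed
  have oneS: "\<one>\<^bsub>W (Suc n)\<^esub> \<in> carrier (W (Suc n))"
    unfolding one_W_Suc by (rule intro) (auto simp: C_closed)
  have one_actS: "wr_act \<one>\<^bsub>W (Suc n)\<^esub> v = v" if "v \<in> points X (Suc n)" for v
    using that unfolding one_W_Suc by (auto simp: points_Suc one C_one)
  have multS: "z \<otimes>\<^bsub>W (Suc n)\<^esub> w \<in> carrier (W (Suc n))"
    "\<And>v. v \<in> points X (Suc n) \<Longrightarrow> wr_act (z \<otimes>\<^bsub>W (Suc n)\<^esub> w) v = wr_act z (wr_act w v)"
    if zw: "z \<in> carrier (W (Suc n))" "w \<in> carrier (W (Suc n))" for z w
  proof -
    obtain b g c h where z: "z = b # g" "b \<in> ?B" "g \<in> carrier (W n)"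
      and w: "w = c # h" "c \<in> ?B" "h \<in> carrier (W n)" using elim zw by metis
    have bc: "b v \<in> P" "c v \<in> P" if "v \<in> points X n" for v
      using z w that by (auto dest: PiE_mem)
    show "z \<otimes>\<^bsub>W (Suc n)\<^esub> w \<in> carrier (W (Suc n))"
      unfolding z(1) w(1) mult_W_Suc using z w closed bc by (intro intro) (auto simp: C_closed)
    fix v assume "v \<in> points X (Suc n)"
    then obtain x u where v: "v = x # u" "x \<in> X" "u \<in> points X n" by (auto simp: points_Suc)
    have u: "wr_act h u \<in> points X n" "wr_act g (wr_act h u) \<in> points X n"
      using v z w closed by auto
    have "wr_act (z \<otimes>\<^bsub>W (Suc n)\<^esub> w) v =
      (b (wr_act g (wr_act h u)) \<otimes>\<^bsub>C\<^esub> c (wr_act h u)) x # wr_act g (wr_act h u)"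
      unfolding z(1) w(1) mult_W_Suc v(1) using u v z w by (simp add: mult inv1)
    also have "\<dots> = wr_act z (wr_act w v)"
      using u v bc by (simp add: z w C_mult)
    finally show "wr_act (z \<otimes>\<^bsub>W (Suc n)\<^esub> w) v = wr_act z (wr_act w v)" .
  qed
  have faithS: "z = w" if zw: "z \<in> carrier (W (Suc n))" "w \<in> carrier (W (Suc n))"
    and eq: "\<And>v. v \<in> points X (Suc n) \<Longrightarrow> wr_act z v = wr_act w v" for z w
  proof -
    obtain b g c h where z: "z = b # g" "b \<in> ?B" "g \<in> carrier (W n)"
      and w: "w = c # h" "c \<in> ?B" "h \<in> carrier (W n)" using elim zw by metis
    have eq': "b (wr_act g u) x = c (wr_act h u) x \<and> wr_act g u = wr_act h u"
      if "x \<in> X" "u \<in> points X n" for x u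
      using eq[of "x # u"] that by (auto simp: points_Suc z(1) w(1))
    have "g = h" using X_nonempty eq' z w by (intro faith) blast+
    moreover have "b = c"
    proof (rule PiE_ext[OF z(2) w(2)])
      fix v assume v: "v \<in> points X n"
      \<comment> \<open>The label at \<open>v\<close> is read off over \<open>u\<close>, because
        \<open>b # g\<close> applies the label at the image vertex
        \<open>wr_act g u\<close>.\<close>
      define u where "u = wr_act (inv\<^bsub>W n\<^esub> g) v"
      have u: "u \<in> points X n" "wr_act g u = v" using v z closed inv2 by (auto simp: u_def)
      show "b v = c v"
        using eq'[OF _ u(1)] u(2) v z w \<open>g = h\<close> by (intro P_ext) (auto dest: PiE_mem)
    qed
    ultimately show ?thesis using z w by simp
  qed
  have invS: "\<exists>w\<in>carrier (W (Suc n)). w \<otimes>\<^bsub>W (Suc n)\<^esub> z = \<one>\<^bsub>W (Suc n)\<^esub>" if z: "z \<in> carrier (W (Suc n))" for z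
  proof -
    obtain b g where z': "z = b # g" "b \<in> ?B" "g \<in> carrier (W n)" using elim z by metis
    \<comment> \<open>The inverse moves \<open>wr_act g v\<close> back to \<open>v\<close>, so its
      label at \<open>v\<close> must undo the label of \<open>b\<close> at
      \<open>wr_act g v\<close>.\<close>
    let ?w = "(\<lambda>v\<in>points X n. inv\<^bsub>C\<^esub> (b (wr_act g v))) # inv\<^bsub>W n\<^esub> g"
    have bP: "b (wr_act g v) \<in> P" if "v \<in> points X n" for v
      using z' that closed by (auto dest: PiE_mem)
    have w: "?w \<in> carrier (W (Suc n))"
      by (rule intro) (use z' bP in \<open>auto simp: C_closed\<close>)
    have "wr_act ?w (wr_act z v) = v" if "v \<in> points X (Suc n)" for v
      using that z' bP by (auto simp: points_Suc closed inv1 C_inv)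
    then have "?w \<otimes>\<^bsub>W (Suc n)\<^esub> z = \<one>\<^bsub>W (Suc n)\<^esub>"
      using w z by (intro faithS) (auto simp: multS oneS one_actS)
    then show ?thesis using w by blast
  qed
  have "group (W (Suc n))"
  proof (rule groupI)
    fix x y z assume *: "x \<in> carrier (W (Suc n))" "y \<in> carrier (W (Suc n))" "z \<in> carrier (W (Suc n))"
    then show "x \<otimes>\<^bsub>W (Suc n)\<^esub> y \<otimes>\<^bsub>W (Suc n)\<^esub> z = x \<otimes>\<^bsub>W (Suc n)\<^esub> (y \<otimes>\<^bsub>W (Suc n)\<^esub> z)"
      by (intro faithS) (auto simp: multS closedS)
  next
    fix x assume "x \<in> carrier (W (Suc n))"
    then show "\<one>\<^bsub>W (Suc n)\<^esub> \<otimes>\<^bsub>W (Suc n)\<^esub> x = x"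
      by (intro faithS) (auto simp: multS oneS one_actS closedS)
  qed (use multS oneS invS in blast)+
  then show ?case
    unfolding acts_def using closedS one_actS multS faithS by blast
qed

lemma group_W: "group (W n)"
  and wr_act_closed: "g \<in> carrier (W n) \<Longrightarrow> v \<in> points X n \<Longrightarrow> wr_act g v \<in> points X n"
  and wr_act_one: "v \<in> points X n \<Longrightarrow> wr_act \<one>\<^bsub>W n\<^esub> v = v"
  and wr_act_mult: "g \<in> carrier (W n) \<Longrightarrow> h \<in> carrier (W n) \<Longrightarrow> v \<in> points X n \<Longrightarrow>
    wr_act (g \<otimes>\<^bsub>W n\<^esub> h) v = wr_act g (wr_act h v)"
  using acts[of n] by (simp_all add: acts_def)

lemma wr_act_faithful: "g \<in> carrier (W n) \<Longrightarrow> h \<in> carrier (W n) \<Longrightarrow>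
    (\<And>v. v \<in> points X n \<Longrightarrow> wr_act g v = wr_act h v) \<Longrightarrow> g = h"
  using acts[of n] unfolding acts_def by blast

end


section \<open>The base-\<open>q\<close> action on the natural numbers\<close>

abbreviation Sym_nat :: "(nat \<Rightarrow> nat) monoid" where "Sym_nat \<equiv> BijGroup UNIV"

lemma carrier_Sym_nat: "f \<in> carrier Sym_nat \<longleftrightarrow> bij f"
  by (simp add: BijGroup_def Bij_def)

lemma mult_Sym_nat: "bij f \<Longrightarrow> bij g \<Longrightarrow> f \<otimes>\<^bsub>Sym_nat\<^esub> g = f \<circ> g"
  by (auto simp: BijGroup_def Bij_def compose_def)

lemma one_Sym_nat: "\<one>\<^bsub>Sym_nat\<^esub> = id"
  by (auto simp: BijGroup_def)

lemma inv_Sym_nat: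
  assumes "\<And>x. g (f x) = x" "\<And>x. f (g x) = x" shows "inv\<^bsub>Sym_nat\<^esub> f = g"
proof (rule group.inv_equality[OF group_BijGroup])
  have *: "g \<circ> f = id" "f \<circ> g = id" using assms by auto
  then have b: "bij f" "bij g" by (auto intro: o_bij)
  then show "g \<otimes>\<^bsub>Sym_nat\<^esub> f = \<one>\<^bsub>Sym_nat\<^esub>" using * by (simp add: mult_Sym_nat one_Sym_nat)
  show "f \<in> carrier Sym_nat" "g \<in> carrier Sym_nat" using b by (simp_all add: carrier_Sym_nat)
qed

text \<open>The element of $W_C$ with the single non-trivial label \<open>\<pi>\<close>, placed at the vertex \<open>v\<close> of level
  \<open>m\<close> of the \<open>q\<close>-ary tree.  Levels are digits, the lowest digit being nearest to the root.\<close>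

definition relabel :: "nat \<Rightarrow> nat \<Rightarrow> nat \<Rightarrow> (nat \<Rightarrow> nat) \<Rightarrow> nat \<Rightarrow> nat" where
  "relabel q m v \<pi> x = (if x mod q ^ m = v
     then v + q ^ m * (\<pi> (x div q ^ m mod q) + q * (x div q ^ m div q)) else x)"

lemma add_mult_less: "(a::nat) < A \<Longrightarrow> b < B \<Longrightarrow> a + A * b < A * B"
proof -
  assume "a < A" "b < B"
  then have "a + A * b < A * Suc b" "A * Suc b \<le> A * B"
    by (simp, intro mult_le_mono2) simp
  then show ?thesis by linarith
qed

locale numbered_perm_group = finite_perm_group +
  fixes ix :: "'a \<Rightarrow> nat"
  assumes bij_ix: "bij_betw ix X {..<card X}"
begin

abbreviation "q \<equiv> card X"

lemma q_pos[simp]: "0 < q"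
  using finite_X X_nonempty by (simp add: card_gt_0_iff)

definition xi :: "nat \<Rightarrow> 'a" where "xi = inv_into X ix"

lemma xi_closed: "d < q \<Longrightarrow> xi d \<in> X"
  and ix_xi: "d < q \<Longrightarrow> ix (xi d) = d"
  and ix_less: "x \<in> X \<Longrightarrow> ix x < q"
  and xi_ix: "x \<in> X \<Longrightarrow> xi (ix x) = x"
proof -
  show "d < q \<Longrightarrow> xi d \<in> X" unfolding xi_def
    using bij_ix by (metis bij_betw_def inv_into_into lessThan_iff)
  show "d < q \<Longrightarrow> ix (xi d) = d" unfolding xi_def
    using bij_ix by (metis bij_betw_def f_inv_into_f lessThan_iff)
  show "x \<in> X \<Longrightarrow> ix x < q" using bij_ix by (auto simp: bij_betw_def)
  show "x \<in> X \<Longrightarrow> xi (ix x) = x" unfolding xi_def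
    using bij_ix by (metis bij_betw_def inv_into_f_f)
qed

text \<open>The head of a point is its coordinate farthest from the root and becomes the most
  significant digit.\<close>

fun num :: "'a list \<Rightarrow> nat" where
  "num [] = 0"
| "num (a # v) = num v + q ^ length v * ix a"

fun dig :: "nat \<Rightarrow> nat \<Rightarrow> 'a list" where
  "dig 0 x = []"
| "dig (Suc n) x = xi (x div q ^ n mod q) # dig n x"

lemma points_length: "v \<in> points X n \<Longrightarrow> length v = n"
  by (simp add: points_def)

lemma dig_closed[simp]: "dig n x \<in> points X n"
  by (induction n) (auto simp: points_Suc xi_closed)

lemma num_less: "v \<in> points X n \<Longrightarrow> num v < q ^ n"
proof (induction n arbitrary: v)
  case (Suc n)
  then obtain a u where v: "v = a # u" "a \<in> X" "u \<in> points X n" by (auto simp: points_Suc)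
  then show ?case using add_mult_less[OF Suc.IH[OF v(3)] ix_less[OF v(2)]]
    by (simp add: points_length mult.commute)
qed simp

lemma num_dig: "num (dig n x) = x mod q ^ n"
proof (induction n)
  case (Suc n)
  have "x mod q ^ Suc n = q ^ n * (x div q ^ n mod q) + x mod q ^ n"
    by (metis mod_mult2_eq power_Suc2)
  then show ?case using Suc by (simp add: points_length[OF dig_closed] ix_xi)
qed simp

lemma dig_num: "v \<in> points X n \<Longrightarrow> dig n (num v + q ^ n * y) = v"
proof (induction n arbitrary: v y)
  case (Suc n)
  then obtain a u where v: "v = a # u" "a \<in> X" "u \<in> points X n" by (auto simp: points_Suc)
  have e: "num v + q ^ Suc n * y = num u + q ^ n * (ix a + q * y)"
    using v by (simp add: points_length algebra_simps)
  have d: "(num u + q ^ n * (ix a + q * y)) div q ^ n mod q = ix a"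
    using num_less[OF v(3)] ix_less[OF v(2)] by simp
  show ?case unfolding dig.simps e d Suc.IH[OF v(3)] xi_ix[OF v(2)] by (simp add: v(1))
qed simp

text \<open>Only the lowest \<open>n\<close> digits are moved and the others kept, which lets all
  levels act on the same set of numbers.\<close>

definition act :: "nat \<Rightarrow> ('a list \<Rightarrow> 'a \<Rightarrow> 'a) list \<Rightarrow> nat \<Rightarrow> nat" where
  "act n g x = num (wr_act g (dig n x)) + q ^ n * (x div q ^ n)"

lemma dig_act: "g \<in> carrier (W n) \<Longrightarrow> dig n (act n g x) = wr_act g (dig n x)"
  unfolding act_def by (intro dig_num wr_act_closed dig_closed)

lemma act_div: "g \<in> carrier (W n) \<Longrightarrow> act n g x div q ^ n = x div q ^ n"
  using num_less[OF wr_act_closed[OF _ dig_closed]] by (simp add: act_def)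

lemma act_mult:
  assumes "g \<in> carrier (W n)" "h \<in> carrier (W n)"
  shows "act n (g \<otimes>\<^bsub>W n\<^esub> h) = act n g \<circ> act n h"
proof
  fix x
  have "act n (g \<otimes>\<^bsub>W n\<^esub> h) x = num (wr_act g (wr_act h (dig n x))) + q ^ n * (x div q ^ n)"
    using assms by (simp add: act_def wr_act_mult)
  also have "\<dots> = act n g (act n h x)"
    using dig_act[OF assms(2), of x] act_div[OF assms(2), of x] by (simp add: act_def[of n g])
  finally show "act n (g \<otimes>\<^bsub>W n\<^esub> h) x = (act n g \<circ> act n h) x" by simp
qed

lemma act_one: "act n \<one>\<^bsub>W n\<^esub> = id"
  by (auto simp: act_def wr_act_one num_dig)

lemma bij_act: assumes "g \<in> carrier (W n)" shows "bij (act n g)"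
proof -
  interpret group "W n" by (rule group_W)
  have "act n (inv\<^bsub>W n\<^esub> g) \<circ> act n g = id" "act n g \<circ> act n (inv\<^bsub>W n\<^esub> g) = id"
    using act_mult[of "inv\<^bsub>W n\<^esub> g" n g] act_mult[of g n "inv\<^bsub>W n\<^esub> g"] assms by (auto simp: act_one)
  then show ?thesis by (rule o_bij)
qed

lemma act_faithful: "inj_on (act n) (carrier (W n))"
proof (rule inj_onI)
  fix g h assume g: "g \<in> carrier (W n)" and h: "h \<in> carrier (W n)" and eq: "act n g = act n h"
  show "g = h"
  proof (rule wr_act_faithful[OF g h])
    fix v assume v: "v \<in> points X n"
    have "dig n (num v) = v" using dig_num[OF v, of 0] by simp
    then show "wr_act g v = wr_act h v" using dig_act[OF g, of "num v"] dig_act[OF h, of "num v"] eq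
      by simp
  qed
qed

text \<open>Numbers that are not digits are fixed, so a label differs from the identity at finitely
  many arguments only.\<close>

definition label :: "('a \<Rightarrow> 'a) \<Rightarrow> nat \<Rightarrow> nat" where
  "label p d = (if d < q then ix (p (xi d)) else d)"

lemma act_Suc:
  assumes b: "b \<in> (\<Pi>\<^sub>E v\<in>points X n. P)" and g: "g \<in> carrier (W n)"
  shows "act (Suc n) (b # g) x = num (wr_act g (dig n x)) +
    q ^ n * (label (b (wr_act g (dig n x))) (x div q ^ n mod q) + q * (x div q ^ n div q))"
proof -
  have "length (wr_act g (dig n x)) = n"
    by (rule points_length[OF wr_act_closed[OF g dig_closed]])
  moreover have "x div (q * q ^ n) = x div q ^ n div q"
    by (metis div_mult2_eq mult.commute)
  ultimately show ?thesis by (simp add: act_def label_def algebra_simps)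
qed

text \<open>The embedding adds trivial labels at level \<open>n\<close>, so digit \<open>n\<close>
  stays fixed and the permutation of the numbers is unchanged.\<close>

lemma act_embed:
  assumes g: "g \<in> carrier (W n)"
  shows "wreath_embed X P n g \<in> carrier (W (Suc n))"
    "act (Suc n) (wreath_embed X P n g) = act n g"
proof -
  let ?b = "\<lambda>v\<in>points X n. \<one>\<^bsub>C\<^esub>"
  have e: "wreath_embed X P n g = ?b # g" by (simp add: wreath_embed_def base_group_def)
  have b: "?b \<in> (\<Pi>\<^sub>E v\<in>points X n. P)" by (simp add: C_closed)
  show "wreath_embed X P n g \<in> carrier (W (Suc n))"
    unfolding e carrier_W_Suc using b g by blast
  have "label (?b (wr_act g (dig n x))) d = d" for x d
    using wr_act_closed[OF g dig_closed[of n x]] by (simp add: label_def C_one xi_closed ix_xi)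
  then have "act (Suc n) (?b # g) x = act n g x" for x
    unfolding act_Suc[OF b g] by (simp add: act_def)
  then show "act (Suc n) (wreath_embed X P n g) = act n g" unfolding e by blast
qed

sublocale realised_sequence Sym_nat W "wreath_embed X P" act
proof (intro realised_sequence.intro group_BijGroup realised_sequence_axioms.intro group_W act_faithful)
  show "act n \<in> hom (W n) Sym_nat" for n
    by (rule homI) (auto simp: carrier_Sym_nat mult_Sym_nat bij_act act_mult)
qed (rule act_embed; assumption)+

lemma act_base:
  assumes b: "b \<in> (\<Pi>\<^sub>E v\<in>points X n. P)"
  shows "b # \<one>\<^bsub>W n\<^esub> \<in> carrier (W (Suc n))"
    "act (Suc n) (b # \<one>\<^bsub>W n\<^esub>) x =
      x mod q ^ n + q ^ n * (label (b (dig n x)) (x div q ^ n mod q) + q * (x div q ^ n div q))"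
proof -
  have one: "\<one>\<^bsub>W n\<^esub> \<in> carrier (W n)"
    by (rule monoid.one_closed[OF group.is_monoid[OF group_W]])
  show "b # \<one>\<^bsub>W n\<^esub> \<in> carrier (W (Suc n))" unfolding carrier_W_Suc using b one by blast
  show "act (Suc n) (b # \<one>\<^bsub>W n\<^esub>) x =
      x mod q ^ n + q ^ n * (label (b (dig n x)) (x div q ^ n mod q) + q * (x div q ^ n div q))"
    by (simp add: act_Suc[OF b one] wr_act_one num_dig)
qed

lemma relabel_in_limit_image:
  assumes "p \<in> P" "v < q ^ m" shows "relabel q m v (label p) \<in> limit_image"
proof -
  let ?b = "\<lambda>u\<in>points X m. if num u = v then p else \<one>\<^bsub>C\<^esub>"
  have b: "?b \<in> (\<Pi>\<^sub>E v\<in>points X m. P)" using assms by (auto simp: C_closed)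
  have "label \<one>\<^bsub>C\<^esub> d = d" for d by (simp add: label_def C_one xi_closed ix_xi)
  moreover have "x mod q ^ m + q ^ m * (x div q ^ m mod q + q * (x div q ^ m div q)) = x" for x
    by simp
  ultimately have "relabel q m v (label p) x = act (Suc m) (?b # \<one>\<^bsub>W m\<^esub>) x" for x
    unfolding act_base(2)[OF b] by (auto simp: relabel_def num_dig)
  then have "relabel q m v (label p) = act (Suc m) (?b # \<one>\<^bsub>W m\<^esub>)" by blast
  then show ?thesis using act_base(1)[OF b] unfolding limit_image_def by blast
qed

text \<open>Induction on the level: \<open>b # h\<close> acts as its base part after
  \<open>h\<close>, and the base part is a composite of relabellings at the single vertices of level
  \<open>n\<close>.\<close>

lemma act_generated:
  assumes id: "id \<in> \<Gamma>" and comp: "\<And>f h. f \<in> \<Gamma> \<Longrightarrow> h \<in> \<Gamma> \<Longrightarrow> f \<circ> h \<in> \<Gamma>"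
    and gen: "\<And>m v p. v < q ^ m \<Longrightarrow> p \<in> P \<Longrightarrow> relabel q m v (label p) \<in> \<Gamma>"
  shows "g \<in> carrier (W n) \<Longrightarrow> act n g \<in> \<Gamma>"
proof (induction n arbitrary: g)
  case 0
  then have "act 0 g = id" by (auto simp: act_def)
  then show ?case using id by argo
next
  case (Suc n)
  then obtain b h where g: "g = b # h" and b: "b \<in> (\<Pi>\<^sub>E v\<in>points X n. P)" and h: "h \<in> carrier (W n)"
    unfolding carrier_W_Suc by blast
  \<comment> \<open>\<open>F S\<close> applies only the labels at vertices in \<open>S\<close>. It
    fixes the lowest \<open>n\<close> digits, so vertices can be added one by one without
    interference.\<close>
  define F where "F S x = (if x mod q ^ n \<in> S then x mod q ^ n + q ^ n *
    (label (b (dig n x)) (x div q ^ n mod q) + q * (x div q ^ n div q)) else x)" for S x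
  have dig_mod: "dig n (x mod q ^ n) = dig n x" for x
    using dig_num[OF dig_closed[of n x], of 0] by (simp add: num_dig)
  have F_mod: "F S x mod q ^ n = x mod q ^ n" for S x by (simp add: F_def)
  have "F S \<in> \<Gamma>" if "finite S" "S \<subseteq> {..<q ^ n}" for S using that
  proof (induction rule: finite_induct)
    case empty
    have "F {} = id" by (auto simp: F_def)
    then show ?case using id by argo
  next
    case (insert v S)
    let ?r = "relabel q n v (label (b (dig n v)))"
    have "F (insert v S) x = ?r (F S x)" for x
    proof (cases "x mod q ^ n = v")
      case True
      then have "F S x = x" using insert(2) by (simp add: F_def)
      then show ?thesis using True dig_mod[of x] by (simp add: F_def relabel_def)
    next
      case False
      then have "?r (F S x) = F S x" using F_mod[of S x] by (simp add: relabel_def)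
      then show ?thesis using False by (simp add: F_def)
    qed
    then have eq: "F (insert v S) = ?r \<circ> F S" by auto
    have "b (dig n v) \<in> P" using b dig_closed by (rule PiE_mem)
    then show ?case unfolding eq using insert.prems by (intro comp gen insert.IH) auto
  qed
  then have "F {..<q ^ n} \<in> \<Gamma>" by simp
  from comp[OF this Suc.IH[OF h]] have "F {..<q ^ n} \<circ> act n h \<in> \<Gamma>" .
  moreover have "act (Suc n) g = F {..<q ^ n} \<circ> act n h"
  proof
    fix x
    have "act n h x mod q ^ n = num (wr_act h (dig n x))"
      using num_dig[of n "act n h x"] dig_act[OF h] by simp
    then show "act (Suc n) g x = (F {..<q ^ n} \<circ> act n h) x"
      unfolding g act_Suc[OF b h] using num_less[OF wr_act_closed[OF h dig_closed]]
      by (simp add: F_def dig_act[OF h] act_div[OF h])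
  qed
  ultimately show ?case by argo
qed

end


section \<open>Collapsing letters\<close>

text \<open>\<open>a t\<close> is \<open>x\<close> if \<open>t\<close> is the pair of
  \<open>x\<close> and its least witness, and \<open>t\<close> otherwise. Each value is hit finitely
  often, while knowing when \<open>a\<close> stays above \<open>x\<close> would bound the search for
  a witness.\<close>

lemma undecidable_threshold:
  obtains a where "computable a" "\<And>m. \<exists>s. \<forall>t\<ge>s. m < a t" "\<not> decidable_pred (\<lambda>z. \<exists>t\<ge>p2 z. a t \<le> p1 z)"
proof -
  obtain T where T: "decidable_pred (\<lambda>z. T (p1 z) (p2 z))" "\<not> decidable_pred (\<lambda>x. \<exists>n. T n x)"
    using undecidable_projection by blast
  define a where "a t = (if T (p2 t) (p1 t) \<and> (\<forall>k<p2 t. \<not> T k (p1 t)) then p1 t else t)" for t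
  show ?thesis
  proof
    show "computable a" unfolding a_def by (intro computable_intros decidable_pred_pairD[OF T(1)])
    show large: "\<exists>s. \<forall>t\<ge>s. m < a t" for m
    proof -
      \<comment> \<open>A value at most \<open>m\<close> comes from \<open>t \<le> m\<close> or from
        one pair for each \<open>x \<le> m\<close>. Where \<open>x\<close> has no witness the
        \<open>LEAST\<close> is arbitrary, and the set stays finite.\<close>
      have "{t. a t \<le> m} \<subseteq> {..m} \<union> (\<lambda>x. pr x (LEAST n. T n x)) ` {..m}"
      proof
        fix t assume t: "t \<in> {t. a t \<le> m}"
        show "t \<in> {..m} \<union> (\<lambda>x. pr x (LEAST n. T n x)) ` {..m}"
        proof (cases "T (p2 t) (p1 t) \<and> (\<forall>k<p2 t. \<not> T k (p1 t))")
          case True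
          then have "(LEAST n. T n (p1 t)) = p2 t"
            by (intro Least_equality) (auto simp: not_less[symmetric])
          then have "t = pr (p1 t) (LEAST n. T n (p1 t))" by simp
          moreover have "p1 t \<le> m" using t True by (simp add: a_def)
          ultimately show ?thesis by blast
        next
          case False
          then have "a t = t" unfolding a_def by (rule if_not_P)
          then show ?thesis using t by simp
        qed
      qed
      then have "finite {t. a t \<le> m}" by (rule finite_subset) simp
      then obtain s where "\<forall>t\<in>{t. a t \<le> m}. t < s" using finite_nat_set_iff_bounded by blast
      then show ?thesis by (intro exI[of _ s]) (auto simp: not_le[symmetric])
    qed
    show "\<not> decidable_pred (\<lambda>z. \<exists>t\<ge>p2 z. a t \<le> p1 z)"
    proof
      assume D: "decidable_pred (\<lambda>z. \<exists>t\<ge>p2 z. a t \<le> p1 z)"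
      \<comment> \<open>The first stage from which \<open>a\<close> stays above \<open>x\<close>;
        under the assumption it can be found by search.\<close>
      define s where "s x = (LEAST s. \<not> (\<exists>t\<ge>s. a t \<le> x))" for x
      have ex: "\<exists>s. \<not> (\<exists>t\<ge>s. a t \<le> x)" for x using large[of x] by (meson not_le)
      \<comment> \<open>\<open>computable_Least\<close> expects the bound variable first and the
        parameter second, hence the swapped pair.\<close>
      have "decidable_pred (\<lambda>z. \<not> (\<exists>t\<ge>p2 (pr (p2 z) (p1 z)). a t \<le> p1 (pr (p2 z) (p1 z))))"
        by (intro decidable_pred_not decidable_pred_comp[OF D] computable_intros)
      then have "computable s" unfolding s_def by (intro computable_Least ex) simp
      have s: "\<not> (\<exists>t\<ge>s x. a t \<le> x)" for x unfolding s_def using LeastI_ex[OF ex] .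
      have "(\<exists>n. T n x) \<longleftrightarrow> (\<exists>n<s x. T n x)" for x
      proof
        assume ex: "\<exists>n. T n x"
        define n where "n = (LEAST n. T n x)"
        have n: "T n x" "\<forall>k<n. \<not> T k x"
          unfolding n_def using LeastI_ex[OF ex] not_less_Least by blast+
        then have "a (pr x n) \<le> x" by (simp add: a_def)
        \<comment> \<open>The least witness \<open>n\<close> pulls \<open>a\<close> down to
          \<open>x\<close> at stage \<open>pr x n\<close>, which must precede \<open>s x\<close>;
          and \<open>n \<le> pr x n\<close>.\<close>
        then have "pr x n < s x" using s[of x] not_le by blast
        then show "\<exists>n<s x. T n x" using n(1) le_pr2[of n x] le_less_trans by blast
      qed blast
      moreover have "decidable_pred (\<lambda>x. \<exists>n<s x. T n x)"
        by (intro decidable_pred_bex \<open>computable s\<close> T(1))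
      ultimately show False using T(2) by simp
    qed
  qed
qed

section \<open>Arithmetic of relabelling a single digit\<close>

lemma relabel_mod: "relabel q m v \<pi> x mod q ^ m = x mod q ^ m"
  by (auto simp: relabel_def)

lemma relabel_add:
  assumes "m < N" "0 < q"
  shows "relabel q m v \<pi> (x + q ^ N * h) = relabel q m v \<pi> x + q ^ N * h"
proof -
  obtain k where "N = m + Suc k" using assms less_iff_Suc_add by force
  then have e: "q ^ N * h = q ^ m * (q * (q ^ k * h))" by (simp add: power_add)
  have "(x + q ^ m * (q * (q ^ k * h))) div q ^ m = x div q ^ m + q * (q ^ k * h)"
    "(x div q ^ m + q * (q ^ k * h)) div q = x div q ^ m div q + q ^ k * h"
    "(x + q ^ m * (q * (q ^ k * h))) mod q ^ m = x mod q ^ m"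
    "(x div q ^ m + q * (q ^ k * h)) mod q = x div q ^ m mod q"
    using assms by simp_all
  then show ?thesis unfolding e relabel_def by (simp add: distrib_left)
qed

lemma relabel_less:
  assumes "m < N" "0 < q" "x < q ^ N" "\<And>d. d < q \<Longrightarrow> \<pi> d < q"
  shows "relabel q m v \<pi> x < q ^ N"
proof (cases "x mod q ^ m = v")
  case True
  obtain k where k: "N = m + Suc k" using assms less_iff_Suc_add by force
  have v: "v < q ^ m" using True assms(2) by auto
  have "x < q ^ k * (q * q ^ m)" using assms(3) unfolding k by (simp add: power_add mult.commute mult.left_commute)
  then have "x div q ^ m div q < q ^ k"
    by (metis div_mult2_eq less_mult_imp_div_less mult.commute)
  moreover have "\<pi> (x div q ^ m mod q) < q" using assms(2,4) by simp
  ultimately have "v + q ^ m * (\<pi> (x div q ^ m mod q) + q * (x div q ^ m div q)) < q ^ m * (q * q ^ k)"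
    using v by (intro add_mult_less)
  then show ?thesis using True unfolding relabel_def k by (simp add: power_add mult.left_commute)
qed (use assms in \<open>simp add: relabel_def\<close>)

lemma relabel_relabel:
  assumes "\<And>d. d < q \<Longrightarrow> \<pi>' d < q" "0 < q"
  shows "relabel q m v \<pi> (relabel q m v \<pi>' x) = relabel q m v (\<pi> \<circ> \<pi>') x"
proof (cases "x mod q ^ m = v")
  case True
  then have "v < q ^ m" using assms(2) by auto
  moreover have "\<pi>' (x div q ^ m mod q) < q" using assms by simp
  ultimately show ?thesis using True by (simp add: relabel_def)
qed (simp add: relabel_def)

lemma relabel_id: assumes "\<And>d. d < q \<Longrightarrow> \<pi> d = d" "0 < q" shows "relabel q m v \<pi> = id"
  using assms by (auto simp: relabel_def fun_eq_iff)

text \<open>A letter is a number \<open>2i\<close> or \<open>2i + 1\<close> (generator or inverse), where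
  \<open>i = pr s (pr m (pr v c))\<close> stands for the label \<open>c\<close> at the vertex \<open>v\<close> of level \<open>m\<close>, born at
  stage \<open>s\<close>.  It collapses to the identity as soon as \<open>a u \<le> m\<close> for some \<open>u \<ge> s\<close>.\<close>

locale collapsing_letters =
  fixes q :: nat and a :: "nat \<Rightarrow> nat" and tab tab' :: "nat \<Rightarrow> nat \<Rightarrow> nat"
  assumes q_positive: "0 < q"
    and tab_less: "d < q \<Longrightarrow> tab c d < q" "d < q \<Longrightarrow> tab' c d < q"
    and a_large: "\<exists>s. \<forall>t\<ge>s. m < a t"
begin

definition birth :: "nat \<Rightarrow> nat" where "birth j = p1 (j div 2)"
definition level :: "nat \<Rightarrow> nat" where "level j = p1 (p2 (j div 2))"
definition vertex :: "nat \<Rightarrow> nat" where "vertex j = p1 (p2 (p2 (j div 2)))"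
definition table :: "nat \<Rightarrow> nat \<Rightarrow> nat" where
  "table j d = (if j mod 2 = 0 then tab (p2 (p2 (p2 (j div 2)))) d else tab' (p2 (p2 (p2 (j div 2)))) d)"

definition letter_action :: "nat \<Rightarrow> nat \<Rightarrow> nat" where
  "letter_action j = relabel q (level j) (vertex j) (table j)"

text \<open>Only collapses before time \<open>t\<close> are taken into account. The search is
  bounded, unlike the one in \<open>final\<close>, which \<open>stage\<close> approximates.\<close>

definition stage :: "nat \<Rightarrow> nat \<Rightarrow> nat \<Rightarrow> nat" where
  "stage t j x = (if \<exists>u<t. birth j \<le> u \<and> a u \<le> level j then x else letter_action j x)"

definition final :: "nat \<Rightarrow> nat \<Rightarrow> nat" where
  "final j x = (if \<exists>u\<ge>birth j. a u \<le> level j then x else letter_action j x)"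

lemma table_less: "d < q \<Longrightarrow> table j d < q"
  by (simp add: table_def tab_less)

lemma letter_action_add:
  "level j < N \<Longrightarrow> letter_action j (x + q ^ N * h) = letter_action j x + q ^ N * h"
  unfolding letter_action_def by (intro relabel_add q_positive)

lemma letter_action_less: "level j < N \<Longrightarrow> x < q ^ N \<Longrightarrow> letter_action j x < q ^ N"
  unfolding letter_action_def by (intro relabel_less table_less q_positive)

lemma letter_action_low:
  assumes "level j < N"
  shows "letter_action j x div q ^ N = x div q ^ N"
    "letter_action j x mod q ^ N = letter_action j (x mod q ^ N)"
proof -
  have N: "0 < q ^ N" using q_positive by simp
  have *: "letter_action j x = letter_action j (x mod q ^ N) + q ^ N * (x div q ^ N)"
    using letter_action_add[OF assms, of "x mod q ^ N" "x div q ^ N"] by simp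
  have "letter_action j (x mod q ^ N) < q ^ N" using letter_action_less[OF assms] N by simp
  then show "letter_action j x div q ^ N = x div q ^ N"
    "letter_action j x mod q ^ N = letter_action j (x mod q ^ N)"
    unfolding * using N by simp_all
qed

lemma letter_action_high: "N \<le> level j \<Longrightarrow> letter_action j x mod q ^ N = x mod q ^ N"
  unfolding letter_action_def
  by (metis le_imp_power_dvd mod_mod_cancel relabel_mod)

text \<open>At stage \<open>t\<close>, let \<open>\<nu>\<close> be the least value of \<open>a\<close> still to come.  The letters of level at least
  \<open>\<nu>\<close> are exactly those which will collapse later, and they do not move the first \<open>\<nu>\<close> digits.\<close>

lemma final_trivial:
  assumes births: "\<And>j. j \<in> set w \<Longrightarrow> birth j \<le> t" and triv: "\<And>x. foldr (stage t) w x = x"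
  shows "foldr final w x = x"
proof -
  define \<nu> where "\<nu> = (LEAST n. \<exists>u\<ge>t. a u = n)"
  have "\<exists>n. \<exists>u\<ge>t. a u = n" by blast
  from LeastI_ex[OF this] have att: "\<exists>u\<ge>t. a u = \<nu>" unfolding \<nu>_def .
  have least: "\<nu> \<le> a u" if "u \<ge> t" for u unfolding \<nu>_def using that by (intro Least_le) blast
  have final: "final j x = (if \<nu> \<le> level j then x else stage t j x)" if "j \<in> set w" for j x
  proof -
    have "(\<exists>u\<ge>birth j. a u \<le> level j) \<longleftrightarrow> (\<exists>u<t. birth j \<le> u \<and> a u \<le> level j) \<or> \<nu> \<le> level j"
      using births[OF that] att least by (meson le_trans not_le)
    then show ?thesis by (simp add: final_def stage_def)
  qed
  \<comment> \<open>Modulo \<open>q ^ \<nu>\<close> the letters that \<open>final\<close> deletes do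
    nothing, so both words agree on the lowest \<open>\<nu>\<close> digits; the surviving letters
    cannot touch the higher ones.\<close>
  have "foldr (stage t) w' x mod q ^ \<nu> = foldr final w' x mod q ^ \<nu> \<and>
      foldr final w' x div q ^ \<nu> = x div q ^ \<nu>" if "set w' \<subseteq> set w" for w' x
    using that
  proof (induction w')
    case (Cons j w')
    have "stage t j y mod q ^ \<nu> = final j z mod q ^ \<nu>" "final j z div q ^ \<nu> = z div q ^ \<nu>"
      if "y mod q ^ \<nu> = z mod q ^ \<nu>" for y z
      using Cons.prems that letter_action_high[of \<nu> j] letter_action_low[of j \<nu>]
      by (auto simp: final stage_def not_le)
    then show ?case using Cons by simp
  qed simp
  from this[of w x] have "x mod q ^ \<nu> = foldr final w x mod q ^ \<nu>" "foldr final w x div q ^ \<nu> = x div q ^ \<nu>"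
    using triv by auto
  then show ?thesis by (metis div_mult_mod_eq)
qed

text \<open>A letter changes at most once, from its action to the identity, and a word has finitely
  many letters.\<close>

lemma eventually_final: "\<exists>s. \<forall>t\<ge>s. \<forall>j\<in>set w. stage t j = final j"
proof (induction w)
  case (Cons j w)
  then obtain s where s: "\<forall>t\<ge>s. \<forall>j\<in>set w. stage t j = final j" by blast
  have "\<exists>s'. \<forall>t\<ge>s'. stage t j = final j"
  proof (cases "\<exists>u\<ge>birth j. a u \<le> level j")
    case True
    then obtain u where "u \<ge> birth j" "a u \<le> level j" by blast
    then have "\<forall>t\<ge>Suc u. stage t j = final j" by (auto simp: stage_def final_def fun_eq_iff)
    then show ?thesis by blast
  next
    case False
    then have "stage t j = final j" for t by (auto simp: stage_def final_def fun_eq_iff)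
    then show ?thesis by blast
  qed
  then obtain s' where "\<forall>t\<ge>s'. stage t j = final j" by blast
  then show ?case using s by (intro exI[of _ "max s s'"]) auto
qed simp

text \<open>Letters of level below \<open>N\<close> neither change nor consult the digits from
  \<open>N\<close> on, so finitely many test points suffice.\<close>

lemma stage_trivial_iff:
  assumes "\<And>j. j \<in> set w \<Longrightarrow> level j < N"
  shows "(\<forall>x. foldr (stage t) w x = x) \<longleftrightarrow> (\<forall>x<q ^ N. foldr (stage t) w x = x)"
proof -
  have "foldr (stage t) w (x + q ^ N * h) = foldr (stage t) w x + q ^ N * h" for x h
    using assms by (induction w) (auto simp: stage_def letter_action_add)
  from this[of "_ mod q ^ N" "_ div q ^ N"] have "foldr (stage t) w x = x"
    if "foldr (stage t) w (x mod q ^ N) = x mod q ^ N" for x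
    using that by (metis mod_mult_div_eq)
  moreover have "x mod q ^ N < q ^ N" for x using q_positive by simp
  ultimately show ?thesis by blast
qed

lemma mem_list_decode_le: "j \<in> set (list_decode n) \<Longrightarrow> j \<le> n"
proof -
  have "j \<in> set w \<Longrightarrow> j \<le> list_encode w" for w
  proof (induction w)
    case (Cons i w)
    then show ?case using le_pr1[of i "list_encode w"] le_pr2[of "list_encode w" i]
      by (auto simp: list_encode_Cons pr_def)
  qed simp
  from this[of "list_decode n"] show "j \<in> set (list_decode n) \<Longrightarrow> j \<le> n" by simp
qed

text \<open>The code \<open>n\<close> bounds every letter, hence its birth and level. So stage
  \<open>n + t\<close> is past all births, and \<open>Suc n\<close> digits suffice for the
  test.\<close>

lemma final_trivial_iff:
  "(\<forall>x. foldr final (list_decode n) x = x) \<longleftrightarrow>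
   (\<exists>t. \<forall>x<q ^ Suc n. foldr (stage (n + t)) (list_decode n) x = x)"
proof -
  let ?w = "list_decode n"
  have le: "birth j \<le> n + t" "level j < Suc n" if "j \<in> set ?w" for j t
  proof -
    have "p1 (j div 2) \<le> j" "p1 (p2 (j div 2)) \<le> j"
      using p1_le[of "j div 2"] p1_le[of "p2 (j div 2)"] p2_le[of "j div 2"] by linarith+
    then show "birth j \<le> n + t" "level j < Suc n"
      using mem_list_decode_le[OF that] by (auto simp: birth_def level_def)
  qed
  have "(\<forall>x. foldr final ?w x = x) \<longleftrightarrow> (\<exists>t. \<forall>x. foldr (stage (n + t)) ?w x = x)"
  proof
    assume *: "\<forall>x. foldr final ?w x = x"
    obtain s where "\<forall>t\<ge>s. \<forall>j\<in>set ?w. stage t j = final j" using eventually_final by blast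
    then have "foldr (stage (n + s)) ?w x = foldr final ?w x" for x
      by (intro foldr_cong) auto
    then show "\<exists>t. \<forall>x. foldr (stage (n + t)) ?w x = x" using * by auto
  qed (use final_trivial le in blast)
  also have "\<dots> \<longleftrightarrow> (\<exists>t. \<forall>x<q ^ Suc n. foldr (stage (n + t)) ?w x = x)"
    using stage_trivial_iff[of ?w "Suc n"] le by simp
  finally show ?thesis .
qed

text \<open>After rewriting by \<open>final_trivial_iff\<close> only the stage is searched without
  bound.\<close>

lemma recursively_enumerable_trivial:
  assumes "computable a" "computable (\<lambda>z. tab (p1 z) (p2 z))" "computable (\<lambda>z. tab' (p1 z) (p2 z))"
  shows "recursively_enumerable {n. \<forall>x. foldr final (list_decode n) x = x}"
  unfolding final_trivial_iff stage_def letter_action_def relabel_def table_def birth_def level_def vertex_def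
  by (intro recursively_enumerableI computable_foldr computable_intros computable_comp[OF assms(1)]
      computable_pairD[OF assms(2)] computable_pairD[OF assms(3)])

end


section \<open>The presentation\<close>

context numbered_perm_group
begin

lemma label_less: "p \<in> P \<Longrightarrow> d < q \<Longrightarrow> label p d < q"
  by (simp add: label_def ix_less P_closed xi_closed)

lemma label_inv: "p \<in> P \<Longrightarrow> d < q \<Longrightarrow> label (inv\<^bsub>C\<^esub> p) (label p d) = d"
  by (simp add: label_def ix_less P_closed xi_closed xi_ix C_inv ix_xi)

lemma label_inv': "p \<in> P \<Longrightarrow> d < q \<Longrightarrow> label p (label (inv\<^bsub>C\<^esub> p) d) = d"
  using label_inv[of "inv\<^bsub>C\<^esub> p" d] group.inv_inv[OF group_C, of p] by (simp add: C_closed)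

lemma finite_P: "finite P"
proof (rule finite_subset)
  show "P \<subseteq> X \<rightarrow>\<^sub>E X"
  proof
    fix p assume p: "p \<in> P"
    then show "p \<in> X \<rightarrow>\<^sub>E X"
      using Bij_imp_extensional[OF P_Bij[OF p]] P_closed[OF p] by (simp add: PiE_iff)
  qed
  show "finite (X \<rightarrow>\<^sub>E X)" by (intro finite_PiE finite_X)
qed

lemma label_nontrivial: assumes "p \<in> P" "p \<noteq> \<one>\<^bsub>C\<^esub>" shows "\<exists>d<q. label p d \<noteq> d"
proof -
  obtain x where x: "x \<in> X" "p x \<noteq> x" using assms P_ext[of p "\<one>\<^bsub>C\<^esub>"] by (auto simp: C_closed C_one)
  then have "label p (ix x) \<noteq> ix x"
    using ix_less xi_ix P_closed[OF assms(1)] by (metis label_def)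
  then show ?thesis using x ix_less by blast
qed

end

locale wreath_presentation = numbered_perm_group +
  fixes a :: "nat \<Rightarrow> nat" and enum :: "nat \<Rightarrow> ('a \<Rightarrow> 'a)"
  assumes a_large: "\<exists>s. \<forall>t\<ge>s. m < a t"
    and enum: "enum ` {..<card P} = P"
begin

definition tab :: "nat \<Rightarrow> nat \<Rightarrow> nat" where
  "tab c d = (if c < card P then label (enum c) d else d)"

definition tab' :: "nat \<Rightarrow> nat \<Rightarrow> nat" where
  "tab' c d = (if c < card P then label (inv\<^bsub>C\<^esub> (enum c)) d else d)"

lemma enum_closed: "c < card P \<Longrightarrow> enum c \<in> P"
  using enum by blast

sublocale collapsing_letters q a tab tab'
  by unfold_locales (auto simp: tab_def tab'_def label_less enum_closed C_closed a_large)

lemma tab_inverse: "d < q \<Longrightarrow> tab c (tab' c d) = d" "d < q \<Longrightarrow> tab' c (tab c d) = d"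
  by (auto simp: tab_def tab'_def enum_closed label_inv label_inv')

text \<open>The function differs from the second projection at finitely many pairs only.\<close>

lemma computable_label: assumes "\<And>c. f c \<noteq> id \<Longrightarrow> c < n" "\<And>c d. q \<le> d \<Longrightarrow> f c d = d"
  shows "computable (\<lambda>z. f (p1 z) (p2 z))"
proof (rule computable_finite_change)
  show "computable p2" by (rule computable_p2)
  have "{z. f (p1 z) (p2 z) \<noteq> p2 z} \<subseteq> (\<lambda>(c, d). pr c d) ` ({..<n} \<times> {..<q})"
  proof
    fix z assume z: "z \<in> {z. f (p1 z) (p2 z) \<noteq> p2 z}"
    then have "f (p1 z) \<noteq> id" by (metis (mono_tags) id_apply mem_Collect_eq)
    with z have "p1 z < n" "p2 z < q"
      using assms(1)[of "p1 z"] assms(2)[of "p2 z" "p1 z"] by (auto simp: not_less[symmetric])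
    then show "z \<in> (\<lambda>(c, d). pr c d) ` ({..<n} \<times> {..<q})"
      by (intro image_eqI[of _ _ "(p1 z, p2 z)"]) auto
  qed
  then show "finite {z. f (p1 z) (p2 z) \<noteq> p2 z}" by (rule finite_subset) simp
qed

lemma computable_tab: "computable (\<lambda>z. tab (p1 z) (p2 z))" "computable (\<lambda>z. tab' (p1 z) (p2 z))"
  by (rule computable_label[of _ "card P"]; auto simp: tab_def tab'_def label_def fun_eq_iff split: if_splits)+

text \<open>\<open>sum_encode\<close> sends \<open>Inl i\<close> to \<open>2 * i\<close> and
  \<open>Inr i\<close> to \<open>Suc (2 * i)\<close>, so letter codes serve directly as letters of
  \<open>final\<close>.\<close>

definition generator :: "nat \<Rightarrow> nat \<Rightarrow> nat" where "generator i = final (2 * i)"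

lemma letter_parts:
  "birth (2 * i) = p1 i" "birth (Suc (2 * i)) = p1 i"
  "level (2 * i) = p1 (p2 i)" "level (Suc (2 * i)) = p1 (p2 i)"
  "vertex (2 * i) = p1 (p2 (p2 i))" "vertex (Suc (2 * i)) = p1 (p2 (p2 i))"
  "table (2 * i) = tab (p2 (p2 (p2 i)))" "table (Suc (2 * i)) = tab' (p2 (p2 (p2 i)))"
  by (simp_all add: birth_def level_def vertex_def table_def fun_eq_iff)

lemma letter_action_inverse:
  "letter_action (Suc (2 * i)) (letter_action (2 * i) x) = x"
  "letter_action (2 * i) (letter_action (Suc (2 * i)) x) = x"
  by (simp_all add: letter_action_def letter_parts relabel_relabel relabel_id tab_inverse tab_less)

lemma final_inverse:
  "final (Suc (2 * i)) (generator i x) = x" "generator i (final (Suc (2 * i)) x) = x"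
  by (auto simp: final_def generator_def letter_parts letter_action_inverse)

lemma bij_generator: "bij (generator i)"
  using final_inverse by (intro o_bij[of "final (Suc (2 * i))"]) auto

lemma generator_closed: "generator i \<in> carrier Sym_nat"
  by (simp add: carrier_Sym_nat bij_generator)

lemma inv_generator: "inv\<^bsub>Sym_nat\<^esub> (generator i) = final (Suc (2 * i))"
  by (rule inv_Sym_nat) (rule final_inverse)+

abbreviation "eval \<equiv> group.word_eval Sym_nat generator"

lemma letter_eval_eq: "group.letter_eval Sym_nat generator l = final (sum_encode l)"
  by (auto simp: inv_generator[unfolded generator_def] group.letter_eval_def[OF group_BijGroup] generator_def sum_encode_def split: sum.split)

lemma bij_eval: "bij (eval w)"
  using group.word_eval_closed[OF group_BijGroup, where \<sigma> = generator, OF generator_closed] by (simp add: carrier_Sym_nat)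

lemma eval_eq: "eval w = foldr final (map sum_encode w)"
proof (induction w)
  case Nil
  show ?case by (simp add: group.word_eval_Nil[OF group_BijGroup] one_Sym_nat)
next
  case (Cons l w)
  have "bij (group.letter_eval Sym_nat generator l)"
    using group.letter_eval_closed[OF group_BijGroup, where \<sigma> = generator, OF generator_closed] by (simp add: carrier_Sym_nat)
  then have "eval (l # w) = group.letter_eval Sym_nat generator l \<circ> eval w"
    by (simp add: group.word_eval_Cons[OF group_BijGroup] mult_Sym_nat bij_eval)
  then show ?case by (simp add: letter_eval_eq Cons)
qed

definition trivial_words :: "nat gword set" where
  "trivial_words = {w. eval w = \<one>\<^bsub>Sym_nat\<^esub>}"

text \<open>Every number is the code of a word, so the right-hand side may range over all
  numbers.\<close>

lemma word_code_trivial_words: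
  "word_code ` trivial_words = {n. \<forall>x. foldr final (list_decode n) x = x}"
proof -
  have *: "w \<in> trivial_words \<longleftrightarrow> (\<forall>x. foldr final (list_decode (word_code w)) x = x)" for w
    by (simp add: trivial_words_def eval_eq one_Sym_nat word_code_def fun_eq_iff)
  have "n = word_code (map sum_decode (list_decode n))" for n
    by (simp add: word_code_def o_def)
  then show ?thesis using * by (auto intro!: image_eqI)
qed

text \<open>Each generator is the identity or a relabelling, and conversely each relabelling is the
  value of a generator born late enough never to collapse.\<close>

lemma range_eval: "range eval = limit_image"
proof
  have "final (sum_encode l) \<in> limit_image" for l
  proof -
    have 1: "id \<in> limit_image" using subgroup.one_closed[OF subgroup_limit_image] by (simp add: one_Sym_nat)
    have 2: "relabel q m v (tab c) \<in> limit_image" for m v c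
    proof (cases "c < card P \<and> v < q ^ m")
      case True
      then show ?thesis using relabel_in_limit_image[OF enum_closed] by (simp add: tab_def[abs_def])
    next
      \<comment> \<open>Either the code names no permutation or the vertex is not a remainder modulo
        \<open>q ^ m\<close>; in both cases nothing moves.\<close>
      case False
      then have "relabel q m v (tab c) = id"
        by (auto simp: relabel_def tab_def fun_eq_iff)
      then show ?thesis using 1 by simp
    qed
    have 3: "generator i \<in> limit_image" for i
    proof -
      have "generator i = id \<or> generator i = relabel q (p1 (p2 i)) (p1 (p2 (p2 i))) (tab (p2 (p2 (p2 i))))"
        by (auto simp: generator_def final_def letter_action_def letter_parts fun_eq_iff)
      then show ?thesis using 1 2 by metis
    qed
    show ?thesis
    proof (cases l)
      case (Inl i)
      then show ?thesis using 3 by (simp add: generator_def sum_encode_def)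
    next
      case (Inr i)
      then show ?thesis using subgroup.m_inv_closed[OF subgroup_limit_image 3[of i]]
        by (simp add: inv_generator sum_encode_def)
    qed
  qed
  then have "group.letter_eval Sym_nat generator l \<in> limit_image" for l
    by (simp add: letter_eval_eq)
  then have "eval w \<in> limit_image" for w
    by (induction w) (auto simp: group.word_eval_Nil[OF group_BijGroup] group.word_eval_Cons[OF group_BijGroup]
      intro: subgroup.one_closed[OF subgroup_limit_image] subgroup.m_closed[OF subgroup_limit_image])
  then show "range eval \<subseteq> limit_image" by blast
next
  have sub: "subgroup (range eval) Sym_nat"
    by (rule group.subgroup_range_word_eval[OF group_BijGroup, where \<sigma> = generator, OF generator_closed])
  \<comment> \<open>The placeholders leave the three closure conditions of
    \<open>act_generated\<close> as goals, while \<open>that\<close> fills its last premise.\<close>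
  have "act n g \<in> range eval" if "g \<in> carrier (W n)" for n g using _ _ _ that
  proof (rule act_generated)
    show "id \<in> range eval" using subgroup.one_closed[OF sub] by (simp add: one_Sym_nat)
    show "f \<circ> h \<in> range eval" if "f \<in> range eval" "h \<in> range eval" for f h
      using subgroup.m_closed[OF sub that] that bij_eval by (auto simp: mult_Sym_nat)
    fix m v p assume "v < q ^ m" "p \<in> P"
    then obtain c where c: "c < card P" "p = enum c" using enum by blast
    \<comment> \<open>A birth date from which \<open>a\<close> stays above \<open>m\<close>, so that
      the generator of level \<open>m\<close> survives.\<close>
    obtain s where s: "\<forall>t\<ge>s. m < a t" using a_large by blast
    let ?i = "pr s (pr m (pr v c))"
    have "tab c = label p" unfolding c(2) using c(1) by (simp add: tab_def fun_eq_iff)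
    then have "generator ?i x = relabel q m v (label p) x" for x
      using s by (auto simp: generator_def final_def letter_action_def letter_parts not_le[symmetric])
    then have "generator ?i = relabel q m v (label p)" by blast
    moreover have "eval [Inl ?i] = generator ?i"
      unfolding eval_eq generator_def by (simp add: sum_encode_def)
    ultimately show "relabel q m v (label p) \<in> range eval" by (metis rangeI)
  qed
  then show "limit_image \<subseteq> range eval" by (auto simp: limit_image_def)
qed

section \<open>The presentation and its word problem\<close>

lemma presented_group_iso: "presented_group trivial_words \<cong> wreath_limit X P"
proof -
  have "presented_group trivial_words \<cong> Sym_nat\<lparr>carrier := range eval\<rparr>"
    unfolding trivial_words_def
    by (rule group.presented_group_word_eval[OF group_BijGroup generator_closed])
  then show ?thesis
    using direct_limit_iso unfolding range_eval wreath_limit_def by (rule iso_trans)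
qed

lemma re_presentation_trivial_words: "computable a \<Longrightarrow> re_presentation trivial_words"
  unfolding re_presentation_def word_code_trivial_words
  by (intro recursively_enumerable_trivial computable_tab)

text \<open>A one-letter word with a non-trivial label is trivial exactly if the letter collapses,
  so a solution of the word problem would decide the threshold predicate.\<close>

lemma undecidable_word_problem:
  assumes "P \<noteq> {\<one>\<^bsub>C\<^esub>}" "\<not> decidable_pred (\<lambda>z. \<exists>t\<ge>p2 z. a t \<le> p1 z)"
  shows "\<not> decidable_word_problem trivial_words"
proof
  assume "decidable_word_problem trivial_words"
  moreover have "{w. word_value trivial_words w = \<one>\<^bsub>presented_group trivial_words\<^esub>} = trivial_words"
    unfolding trivial_words_def
    using group.word_value_word_eval[OF group_BijGroup, where \<sigma> = generator, OF generator_closed] by blast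
  ultimately have D: "decidable_pred (\<lambda>n. \<forall>x. foldr final (list_decode n) x = x)"
    by (simp add: decidable_word_problem_def word_code_trivial_words decidable_iff_decidable_pred)
  obtain p where "p \<in> P" "p \<noteq> \<one>\<^bsub>C\<^esub>" using assms(1) C_closed(2) by blast
  then obtain c d where c: "c < card P" and d: "d < q" "tab c d \<noteq> d"
    using label_nontrivial enum by (metis imageE lessThan_iff tab_def)
  let ?i = "\<lambda>z. pr (p2 z) (pr (p1 z) (pr 0 c))"
  have "(\<forall>x. generator (?i z) x = x) \<longleftrightarrow> (\<exists>t\<ge>p2 z. a t \<le> p1 z)" for z
  proof
    assume triv: "\<forall>x. generator (?i z) x = x"
    show "\<exists>t\<ge>p2 z. a t \<le> p1 z"
    proof (rule ccontr)
      assume "\<not> (\<exists>t\<ge>p2 z. a t \<le> p1 z)"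
      then have "generator (?i z) x = relabel q (p1 z) 0 (tab c) x" for x
        by (auto simp: generator_def final_def letter_action_def letter_parts)
      \<comment> \<open>The test point has digit \<open>d\<close> at level \<open>p1 z\<close> and
        zeros elsewhere: it lies over vertex 0 and is moved by the label.\<close>
      then have "relabel q (p1 z) 0 (tab c) (q ^ p1 z * d) = q ^ p1 z * d" using triv by simp
      then show False using d by (simp add: relabel_def)
    qed
  qed (auto simp: generator_def final_def letter_parts)
  moreover have "decidable_pred (\<lambda>z. \<forall>x. foldr final (list_decode (Suc (pr (2 * ?i z) 0))) x = x)"
    by (intro decidable_pred_comp[OF D] computable_intros)
  moreover have "list_decode (Suc (pr j 0)) = [j]" for j
    using list_encode_inverse[of "[j]"] by (simp add: pr_def)
  ultimately have "decidable_pred (\<lambda>z. \<exists>t\<ge>p2 z. a t \<le> p1 z)" by (simp add: generator_def)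
  then show False using assms(2) by blast
qed

end

theorem theorem7:
  fixes X :: "'a set" and P :: "('a \<Rightarrow> 'a) set"
  assumes "finite X"
    and "subgroup P (BijGroup X)"
    and "P \<noteq> {\<one>\<^bsub>BijGroup X\<^esub>}"
    and "perfect_group (perm_group X P)"
  shows "\<exists>U :: nat gword set.
           re_presentation U \<and>
           presented_group U \<cong> wreath_limit X P \<and>
           \<not> decidable_word_problem U"
proof -
  \<comment> \<open>On the empty set the identity is the only permutation, contrary to the
    non-triviality of \<open>P\<close>.\<close>
  have "X \<noteq> {}"
  proof
    assume "X = {}"
    then have "P \<subseteq> {\<one>\<^bsub>BijGroup X\<^esub>}"
      using subgroup.subset[OF assms(2)] by (auto simp: BijGroup_def Bij_def fun_eq_iff)
    then show False using assms(3) subgroup.one_closed[OF assms(2)] by blast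
  qed
  obtain ix where ix: "bij_betw ix X {..<card X}"
    using ex_bij_betw_finite_nat[OF assms(1)] by (auto simp: atLeast0LessThan)
  interpret numbered_perm_group X P ix
    by (intro numbered_perm_group.intro finite_perm_group.intro numbered_perm_group_axioms.intro
        assms(1,2) \<open>X \<noteq> {}\<close> ix)
  obtain enum where enum: "bij_betw enum {..<card P} P"
    using ex_bij_betw_nat_finite[OF finite_P] by (auto simp: atLeast0LessThan)
  obtain a where a: "computable a" "\<And>m. \<exists>s. \<forall>t\<ge>s. m < a t" "\<not> decidable_pred (\<lambda>z. \<exists>t\<ge>p2 z. a t \<le> p1 z)"
    using undecidable_threshold by blast
  interpret wreath_presentation X P ix a enum
    by unfold_locales (use a(2) enum in \<open>auto simp: bij_betw_def\<close>)
  have "P \<noteq> {\<one>\<^bsub>C\<^esub>}" using assms(3) by (simp add: perm_group_def)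
  then show ?thesis
    using re_presentation_trivial_words[OF a(1)] presented_group_iso undecidable_word_problem[OF _ a(3)]
    by blast
qed

end
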